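(* Let $k$ be a positive integer or $\infty$, let $\Omega$ be an ordinal and let $E$ be a Banach space admitting $\mathcal C^k$ partitions of unity. Then the space $\mathcal C([0,\Omega];E)$ also admits $\mathcal C^k$ partitions of unity.
   Context: All Banach spaces are real and smoothness is in the Fréchet sense. $\mathcal C([0,\Omega];E)$ is the Banach space of continuous $E$-valued functions on the compact ordinal interval $[0,\Omega]$ (order topology), with the supremum norm. A Banach space $X$ admits $\mathcal C^k$ partitions of unity if, for every open covering $\mathcal V$ of $X$, there is a locally finite partition of unity on $X$, subordinate to $\mathcal V$, consisting of functions of class $\mathcal C^k$ on $X$. *)

theory Defs
  imports "HOL-Analysis.Analysis" "HOL-Library.Extended_Nat"
begin

text \<open>
  A \<open>j\<close>-linear map is represented by its values on the argument lists of length \<open>j\<close>;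
  its values on other lists are irrelevant.
\<close>

definition multilin_bound :: "nat \<Rightarrow> ('a::real_normed_vector list \<Rightarrow> 'b::real_normed_vector) \<Rightarrow> real \<Rightarrow> bool"
  where "multilin_bound j A K \<longleftrightarrow>
    (\<forall>vs. length vs = j \<longrightarrow> norm (A vs) \<le> K * prod_list (map norm vs))"

definition bounded_multilinear :: "nat \<Rightarrow> ('a::real_normed_vector list \<Rightarrow> 'b::real_normed_vector) \<Rightarrow> bool"
  where "bounded_multilinear j A \<longleftrightarrow>
    (\<forall>vs i. length vs = j \<longrightarrow> i < j \<longrightarrow> linear (\<lambda>v. A (vs[i := v]))) \<and>
    (\<exists>K. multilin_bound j A K)"

text \<open>
  Class \<open>C\<^sup>k\<close> on the whole space, in the Frechet sense. Here \<open>D j x\<close> is the \<open>j\<close>-th derivative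
  at \<open>x\<close>, an element of the space of bounded \<open>j\<close>-linear maps with the operator norm: \<open>D j\<close> is
  Frechet differentiable in that norm for \<open>j < k\<close>, its derivative in direction \<open>h\<close> being
  \<open>\<lambda>vs. D (Suc j) x (h # vs)\<close>, and \<open>D j\<close> is continuous in that norm for \<open>j \<le> k\<close>. As the
  derivatives are unique, a single sequence \<open>D\<close> also serves for \<open>k = \<infinity>\<close>.
\<close>

definition C_k :: "enat \<Rightarrow> ('a::real_normed_vector \<Rightarrow> 'b::real_normed_vector) \<Rightarrow> bool"
  where "C_k k f \<longleftrightarrow> (\<exists>D :: nat \<Rightarrow> 'a \<Rightarrow> 'a list \<Rightarrow> 'b.
    (\<forall>x. D 0 x [] = f x) \<and>
    (\<forall>j x. enat j \<le> k \<longrightarrow> bounded_multilinear j (D j x)) \<and>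
    (\<forall>j x. enat j < k \<longrightarrow> (\<forall>e>0. \<forall>\<^sub>F y in nhds x.
        multilin_bound j (\<lambda>vs. D j y vs - D j x vs - D (Suc j) x ((y - x) # vs)) (e * norm (y - x)))) \<and>
    (\<forall>j x. enat j \<le> k \<longrightarrow> (\<forall>e>0. \<forall>\<^sub>F y in nhds x.
        multilin_bound j (\<lambda>vs. D j y vs - D j x vs) e)))"

lemma multilin_bound_snoc:
  "multilin_bound (Suc j) A K \<longleftrightarrow>
    (\<forall>vs v. length vs = j \<longrightarrow> norm (A (vs @ [v])) \<le> K * prod_list (map norm vs) * norm v)"
  unfolding multilin_bound_def length_Suc_conv_rev by (fastforce simp: mult.assoc)

lemma multilin_bound_0: "multilin_bound 0 A K \<longleftrightarrow> norm (A []) \<le> K"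
  by (simp add: multilin_bound_def)

lemma prod_list_norm_nonneg: "0 \<le> prod_list (map norm vs)"
  by (induction vs) auto

lemma multilin_bound_blinfun:
  fixes A :: "'a::real_normed_vector list \<Rightarrow> 'a \<Rightarrow>\<^sub>L 'b::real_normed_vector"
  assumes "0 \<le> K" and AB: "\<And>vs v. length vs = j \<Longrightarrow> blinfun_apply (A vs) v = B (vs @ [v])"
  shows "multilin_bound j A K \<longleftrightarrow> multilin_bound (Suc j) B K"
proof
  assume "multilin_bound j A K"
  then have "norm (B (vs @ [v])) \<le> K * prod_list (map norm vs) * norm v" if "length vs = j" for vs v
    using that AB[of vs v] norm_blinfun[of "A vs" v]
      mult_right_mono[of "norm (A vs)" "K * prod_list (map norm vs)" "norm v"]
    by (simp add: multilin_bound_def)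
  then show "multilin_bound (Suc j) B K"
    unfolding multilin_bound_snoc by blast
next
  assume "multilin_bound (Suc j) B K"
  then show "multilin_bound j A K"
    unfolding multilin_bound_snoc using assms
    by (auto simp: multilin_bound_def intro!: norm_blinfun_bound mult_nonneg_nonneg prod_list_norm_nonneg)
qed

lemma multilin_bound_mono: "multilin_bound j A K \<Longrightarrow> K \<le> L \<Longrightarrow> multilin_bound j A L"
  unfolding multilin_bound_def
  using mult_right_mono[OF _ prod_list_norm_nonneg] order_trans by blast

lemma bounded_multilinear_blinfun:
  fixes A :: "'a::real_normed_vector list \<Rightarrow> 'a \<Rightarrow>\<^sub>L 'b::real_normed_vector"
  assumes AB: "\<And>vs v. length vs = j \<Longrightarrow> blinfun_apply (A vs) v = B (vs @ [v])"
  shows "bounded_multilinear j A \<longleftrightarrow> bounded_multilinear (Suc j) B"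
proof -
  have "(\<exists>K. multilin_bound j A K) \<longleftrightarrow> (\<exists>K\<ge>0. multilin_bound j A K)"
    by (meson multilin_bound_mono abs_ge_self abs_ge_zero)
  also have "\<dots> \<longleftrightarrow> (\<exists>K\<ge>0. multilin_bound (Suc j) B K)"
    using multilin_bound_blinfun[OF _ AB] by blast
  also have "\<dots> \<longleftrightarrow> (\<exists>K. multilin_bound (Suc j) B K)"
    by (meson multilin_bound_mono abs_ge_self abs_ge_zero)
  finally have bd: "(\<exists>K. multilin_bound j A K) \<longleftrightarrow> (\<exists>K. multilin_bound (Suc j) B K)" .
  have lin: "(\<forall>vs i. length vs = j \<longrightarrow> i < j \<longrightarrow> linear (\<lambda>v. A (vs[i := v]))) \<longleftrightarrow>
    (\<forall>vs i. length vs = Suc j \<longrightarrow> i < Suc j \<longrightarrow> linear (\<lambda>v. B (vs[i := v])))" (is "?L = ?R")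
  proof
    assume L: ?L
    show ?R
    proof (intro allI impI)
      fix vs :: "'a list" and i assume len: "length vs = Suc j" and i: "i < Suc j"
      then obtain us w where vs: "vs = us @ [w]" "length us = j"
        by (auto simp: length_Suc_conv_rev)
      show "linear (\<lambda>v. B (vs[i := v]))"
      proof (cases "i = j")
        case True
        have "(\<lambda>v. B (vs[i := v])) = blinfun_apply (A us)"
          using vs True AB by (auto simp: list_update_append)
        then show ?thesis
          by (simp add: blinfun.bounded_linear_right bounded_linear.linear)
      next
        case False
        with i have "i < j" by simp
        have "(\<lambda>v. B (vs[i := v])) = (\<lambda>v. blinfun_apply (A (us[i := v])) w)"
          using vs \<open>i < j\<close> AB by (auto simp: list_update_append)
        moreover have "linear (\<lambda>v. A (us[i := v]))" using L vs \<open>i < j\<close> by blast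
        ultimately show ?thesis
          by (auto simp: linear_iff blinfun.bilinear_simps)
      qed
    qed
  next
    assume R: ?R
    show ?L
    proof (intro allI impI)
      fix vs :: "'a list" and i assume len: "length vs = j" and i: "i < j"
      have *: "linear (\<lambda>v. blinfun_apply (A (vs[i := v])) w)" for w
      proof -
        have "linear (\<lambda>v. B ((vs @ [w])[i := v]))" using R len i by simp
        then show ?thesis using len i by (simp add: AB list_update_append)
      qed
      show "linear (\<lambda>v. A (vs[i := v]))"
        using * by (auto simp: linear_iff blinfun.bilinear_simps intro!: blinfun_eqI)
    qed
  qed
  show ?thesis unfolding bounded_multilinear_def bd lin ..
qed

lemma continuous_on_UNIV_iff_norm:
  "continuous_on UNIV f \<longleftrightarrow> (\<forall>x. \<forall>e>0. \<forall>\<^sub>F y in nhds x. norm (f y - f x) \<le> e)"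
  for f :: "'a::real_normed_vector \<Rightarrow> 'b::real_normed_vector"
proof -
  have "continuous_on UNIV f \<longleftrightarrow> (\<forall>x. (f \<longlongrightarrow> f x) (nhds x))"
    by (simp add: continuous_on_def tendsto_at_iff_tendsto_nhds)
  also have "\<dots> \<longleftrightarrow> (\<forall>x. \<forall>e>0. \<forall>\<^sub>F y in nhds x. norm (f y - f x) < e)"
    by (simp add: tendsto_iff dist_norm)
  also have "\<dots> \<longleftrightarrow> (\<forall>x. \<forall>e>0. \<forall>\<^sub>F y in nhds x. norm (f y - f x) \<le> e)"
  proof (rule all_cong1, rule iffI; intro allI impI)
    fix x and e :: real
    assume "\<forall>e>0. \<forall>\<^sub>F y in nhds x. norm (f y - f x) < e" "e > 0"
    then have "\<forall>\<^sub>F y in nhds x. norm (f y - f x) < e" by blast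
    then show "\<forall>\<^sub>F y in nhds x. norm (f y - f x) \<le> e"
      by (rule eventually_mono) simp
  next
    fix x and e :: real
    assume "\<forall>e>0. \<forall>\<^sub>F y in nhds x. norm (f y - f x) \<le> e" and e: "e > 0"
    moreover have "e / 2 > 0" using e by simp
    ultimately have "\<forall>\<^sub>F y in nhds x. norm (f y - f x) \<le> e / 2" by blast
    then show "\<forall>\<^sub>F y in nhds x. norm (f y - f x) < e"
      by (rule eventually_mono) (use e in simp)
  qed
  finally show ?thesis .
qed

lemma C_k_0_iff: "C_k 0 f \<longleftrightarrow> continuous_on UNIV f"
proof -
  note cont = continuous_on_UNIV_iff_norm[of f]
  show ?thesis
  proof
    assume "C_k 0 f" then show "continuous_on UNIV f"
      unfolding cont C_k_def by (auto simp: multilin_bound_0 enat_0_iff)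
  next
    assume "continuous_on UNIV f" then show "C_k 0 f"
      unfolding cont C_k_def
      by (intro exI[of _ "\<lambda>_ x _. f x"]) (auto simp: multilin_bound_0 enat_0_iff bounded_multilinear_def)
  qed
qed

text \<open>The usual recursive description of the classes \<open>C\<^sup>k\<close>.\<close>

lemma C_k_eSuc_iff:
  fixes f :: "'a::real_normed_vector \<Rightarrow> 'b::real_normed_vector"
  shows "C_k (eSuc k) f \<longleftrightarrow>
    (\<exists>f' :: 'a \<Rightarrow> 'a \<Rightarrow>\<^sub>L 'b. (\<forall>x. (f has_derivative blinfun_apply (f' x)) (at x)) \<and> C_k k f')"
proof
  assume "C_k (eSuc k) f"
  then obtain D where D0: "\<And>x. D 0 x [] = f x"
    and ml: "\<And>j x. enat j \<le> eSuc k \<Longrightarrow> bounded_multilinear j (D j x)"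
    and der: "\<And>j x e. enat j < eSuc k \<Longrightarrow> e > 0 \<Longrightarrow> \<forall>\<^sub>F y in nhds x.
        multilin_bound j (\<lambda>vs. D j y vs - D j x vs - D (Suc j) x ((y - x) # vs)) (e * norm (y - x))"
    and con: "\<And>j x e. enat j \<le> eSuc k \<Longrightarrow> e > 0 \<Longrightarrow> \<forall>\<^sub>F y in nhds x.
        multilin_bound j (\<lambda>vs. D j y vs - D j x vs) e"
    unfolding C_k_def by blast
  define D' where "D' j x vs = Blinfun (\<lambda>v. D (Suc j) x (vs @ [v]))" for j x vs
  have le: "enat (Suc j) \<le> eSuc k \<longleftrightarrow> enat j \<le> k" "enat (Suc j) < eSuc k \<longleftrightarrow> enat j < k" for j
    by (simp_all flip: eSuc_enat)
  have D': "blinfun_apply (D' j x vs) v = D (Suc j) x (vs @ [v])"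
    if "enat j \<le> k" "length vs = j" for j x vs v
  proof -
    have m: "bounded_multilinear (Suc j) (D (Suc j) x)" using ml le that by blast
    have "linear (\<lambda>v. D (Suc j) x ((vs @ [0])[j := v]))"
      using m that unfolding bounded_multilinear_def by simp
    then have lin: "linear (\<lambda>v. D (Suc j) x (vs @ [v]))"
      using that by (simp add: list_update_append)
    obtain K where K: "multilin_bound (Suc j) (D (Suc j) x) K"
      using m unfolding bounded_multilinear_def by blast
    have "bounded_linear (\<lambda>v. D (Suc j) x (vs @ [v]))"
      using lin K that unfolding multilin_bound_snoc
      by (intro bounded_linear_intro[of _ "K * prod_list (map norm vs)"])
         (auto simp: linear_iff mult.commute)
    then show ?thesis unfolding D'_def by (simp add: bounded_linear_Blinfun_apply)
  qed
  define f' where "f' x = D' 0 x []" for x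
  have f': "blinfun_apply (f' x) v = D 1 x [v]" for x v
    unfolding f'_def using D'[of 0 "[]"] by (simp flip: zero_enat_def)
  have d: "(f has_derivative blinfun_apply (f' x)) (at x)" for x
    unfolding has_derivative_at_alt
  proof (intro conjI allI impI)
    fix e :: real assume "e > 0"
    then have "\<forall>\<^sub>F y in nhds x. norm (f y - f x - f' x (y - x)) \<le> e * norm (y - x)"
      using der[of 0 e x] by (simp add: multilin_bound_0 D0 f' flip: zero_enat_def)
    then show "\<exists>d>0. \<forall>y. norm (y - x) < d \<longrightarrow> norm (f y - f x - f' x (y - x)) \<le> e * norm (y - x)"
      by (auto simp: eventually_nhds_metric dist_norm)
  qed (rule blinfun.bounded_linear_right)
  have "C_k k f'"
    unfolding C_k_def
  proof (rule exI[of _ D'], intro conjI allI impI)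
    fix j x assume j: "enat j \<le> k"
    show "bounded_multilinear j (D' j x)"
      by (subst bounded_multilinear_blinfun[of j "D' j x" "D (Suc j) x"]) (use D' j ml le in auto)
    fix e :: real assume e: "e > 0"
    show "\<forall>\<^sub>F y in nhds x. multilin_bound j (\<lambda>vs. D' j y vs - D' j x vs) e"
    proof (rule eventually_mono)
      show "\<forall>\<^sub>F y in nhds x. multilin_bound (Suc j) (\<lambda>vs. D (Suc j) y vs - D (Suc j) x vs) e"
        using con[OF _ e] j le by blast
    next
      fix y assume "multilin_bound (Suc j) (\<lambda>vs. D (Suc j) y vs - D (Suc j) x vs) e"
      then show "multilin_bound j (\<lambda>vs. D' j y vs - D' j x vs) e"
        by (subst multilin_bound_blinfun[where B = "\<lambda>vs. D (Suc j) y vs - D (Suc j) x vs"])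
          (use e j in \<open>simp_all add: blinfun.diff_left D'\<close>)
    qed
  next
    fix j x and e :: real assume j: "enat j < k" and e: "e > 0"
    have j': "enat j \<le> k" "enat (Suc j) \<le> k" using j by (auto simp: Suc_ile_eq)
    show "\<forall>\<^sub>F y in nhds x. multilin_bound j
        (\<lambda>vs. D' j y vs - D' j x vs - D' (Suc j) x ((y - x) # vs)) (e * norm (y - x))"
    proof (rule eventually_mono)
      show "\<forall>\<^sub>F y in nhds x. multilin_bound (Suc j)
          (\<lambda>vs. D (Suc j) y vs - D (Suc j) x vs - D (Suc (Suc j)) x ((y - x) # vs)) (e * norm (y - x))"
        using der[OF _ e] j le by blast
    next
      fix y assume "multilin_bound (Suc j)
          (\<lambda>vs. D (Suc j) y vs - D (Suc j) x vs - D (Suc (Suc j)) x ((y - x) # vs)) (e * norm (y - x))"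
      then show "multilin_bound j
          (\<lambda>vs. D' j y vs - D' j x vs - D' (Suc j) x ((y - x) # vs)) (e * norm (y - x))"
        by (subst multilin_bound_blinfun[where B =
              "\<lambda>vs. D (Suc j) y vs - D (Suc j) x vs - D (Suc (Suc j)) x ((y - x) # vs)"])
          (use e j' in \<open>simp_all add: blinfun.diff_left D'\<close>)
    qed
  qed (simp add: f'_def)
  with d show "\<exists>f' :: 'a \<Rightarrow> 'a \<Rightarrow>\<^sub>L 'b. (\<forall>x. (f has_derivative blinfun_apply (f' x)) (at x)) \<and> C_k k f'"
    by blast
next
  assume "\<exists>f' :: 'a \<Rightarrow> 'a \<Rightarrow>\<^sub>L 'b. (\<forall>x. (f has_derivative blinfun_apply (f' x)) (at x)) \<and> C_k k f'"
  then obtain f' :: "'a \<Rightarrow> 'a \<Rightarrow>\<^sub>L 'b"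
    where d: "\<And>x. (f has_derivative blinfun_apply (f' x)) (at x)" and "C_k k f'" by blast
  then obtain D' where D0: "\<And>x. D' 0 x [] = f' x"
    and ml: "\<And>j x. enat j \<le> k \<Longrightarrow> bounded_multilinear j (D' j x)"
    and der: "\<And>j x e. enat j < k \<Longrightarrow> e > 0 \<Longrightarrow> \<forall>\<^sub>F y in nhds x.
        multilin_bound j (\<lambda>vs. D' j y vs - D' j x vs - D' (Suc j) x ((y - x) # vs)) (e * norm (y - x))"
    and con: "\<And>j x e. enat j \<le> k \<Longrightarrow> e > 0 \<Longrightarrow> \<forall>\<^sub>F y in nhds x.
        multilin_bound j (\<lambda>vs. D' j y vs - D' j x vs) e"
    unfolding C_k_def by blast
  define D where "D j x vs = (case j of 0 \<Rightarrow> f x | Suc i \<Rightarrow> blinfun_apply (D' i x (butlast vs)) (last vs))"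
    for j x vs
  have le: "enat (Suc j) \<le> eSuc k \<longleftrightarrow> enat j \<le> k" "enat (Suc j) < eSuc k \<longleftrightarrow> enat j < k" for j
    by (simp_all flip: eSuc_enat)
  have DS: "D (Suc j) x (vs @ [v]) = blinfun_apply (D' j x vs) v" for j x vs v
    by (simp add: D_def)
  have Dz: "D 0 x vs = f x" for x vs by (simp add: D_def)
  have "continuous_on UNIV f"
    using d by (meson has_derivative_continuous continuous_at_imp_continuous_on)
  then have cf: "\<forall>\<^sub>F y in nhds x. norm (f y - f x) \<le> e" if "e > 0" for x e
    using that by (simp add: continuous_on_UNIV_iff_norm)
  show "C_k (eSuc k) f"
    unfolding C_k_def
  proof (rule exI[of _ D], intro conjI allI impI)
    fix j x assume j: "enat j \<le> eSuc k"
    show "bounded_multilinear j (D j x)"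
    proof (cases j)
      case 0 then show ?thesis by (auto simp: bounded_multilinear_def multilin_bound_0)
    next
      case (Suc i) 
      then show ?thesis 
        using bounded_multilinear_blinfun[of i "D' i x" "D (Suc i) x"] DS ml j le by auto
    qed
    fix e :: real assume e: "e > 0"
    show "\<forall>\<^sub>F y in nhds x. multilin_bound j (\<lambda>vs. D j y vs - D j x vs) e"
    proof (cases j)
      case 0 then show ?thesis using cf[OF e] by (simp add: multilin_bound_0 Dz)
    next
      case (Suc i)
      then have "\<forall>\<^sub>F y in nhds x. multilin_bound i (\<lambda>vs. D' i y vs - D' i x vs) e"
        using con e j le by blast
      moreover have "multilin_bound i (\<lambda>vs. D' i y vs - D' i x vs) e \<longleftrightarrow>
          multilin_bound (Suc i) (\<lambda>vs. D (Suc i) y vs - D (Suc i) x vs) e" for y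
        by (rule multilin_bound_blinfun) (use e in \<open>simp_all add: DS blinfun.diff_left\<close>)
      ultimately show ?thesis by (simp add: Suc)
    qed
  next
    fix j x and e :: real assume j: "enat j < eSuc k" and e: "e > 0"
    show "\<forall>\<^sub>F y in nhds x. multilin_bound j
        (\<lambda>vs. D j y vs - D j x vs - D (Suc j) x ((y - x) # vs)) (e * norm (y - x))"
    proof (cases j)
      case 0
      have "\<exists>d>0. \<forall>y. norm (y - x) < d \<longrightarrow> norm (f y - f x - f' x (y - x)) \<le> e * norm (y - x)"
        using d[of x] e unfolding has_derivative_at_alt by blast
      then show ?thesis using 0 DS[of 0 x "[]"]
        by (simp add: multilin_bound_0 Dz D0 eventually_nhds_metric dist_norm)
    next
      case (Suc i)
      then have "\<forall>\<^sub>F y in nhds x. multilin_bound i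
          (\<lambda>vs. D' i y vs - D' i x vs - D' (Suc i) x ((y - x) # vs)) (e * norm (y - x))"
        using der e j le by blast
      moreover have "multilin_bound i
            (\<lambda>vs. D' i y vs - D' i x vs - D' (Suc i) x ((y - x) # vs)) (e * norm (y - x)) \<longleftrightarrow>
          multilin_bound (Suc i)
            (\<lambda>vs. D (Suc i) y vs - D (Suc i) x vs - D (Suc (Suc i)) x ((y - x) # vs)) (e * norm (y - x))" for y
        by (rule multilin_bound_blinfun)
          (use e DS[of "Suc i" x "(y - x) # _"] in \<open>simp_all add: DS blinfun.diff_left\<close>)
      ultimately show ?thesis by (simp add: Suc)
    qed
  qed (simp add: Dz)
qed

definition C_k_partition_of_unity :: "enat \<Rightarrow> 'a::real_normed_vector set set \<Rightarrow> ('a \<Rightarrow> real) set \<Rightarrow> bool"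
  where "C_k_partition_of_unity k \<V> \<Phi> \<longleftrightarrow>
    (\<forall>\<phi>\<in>\<Phi>. C_k k \<phi> \<and> (\<forall>x. 0 \<le> \<phi> x) \<and> (\<exists>V\<in>\<V>. closure {x. \<phi> x \<noteq> 0} \<subseteq> V)) \<and>
    (\<forall>x. \<exists>U. open U \<and> x \<in> U \<and> finite {\<phi>\<in>\<Phi>. \<exists>y\<in>U. \<phi> y \<noteq> 0}) \<and>
    (\<forall>x. supp_sum (\<lambda>\<phi>. \<phi> x) \<Phi> = 1)"

definition admits_C_k_partitions_of_unity :: "enat \<Rightarrow> 'a::real_normed_vector itself \<Rightarrow> bool"
  where "admits_C_k_partitions_of_unity k X \<longleftrightarrow>
    (\<forall>\<V> :: 'a set set. (\<forall>V\<in>\<V>. open V) \<and> \<Union>\<V> = UNIV \<longrightarrow> (\<exists>\<Phi>. C_k_partition_of_unity k \<V> \<Phi>))"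

text \<open>
  A type of sort \<open>{wellorder, order_top, linorder_topology}\<close> is a compact ordinal interval
  \<open>[0, \<Omega>]\<close>, where \<open>\<Omega>\<close> is the order type of the elements below \<open>top\<close>. Continuous functions on it
  are automatically bounded, so that \<open>\<Rightarrow>\<^sub>C\<close> is the full space of continuous functions.
\<close>

lemma compact_atMost_wellorder: "compact {..x :: 'o::{wellorder, linorder_topology}}"
proof (induction x rule: less_induct)
  case (less x)
  show ?case
  proof (rule compactI)
    fix C :: "'o set set"
    assume op: "\<forall>t\<in>C. open t" and cov: "{..x} \<subseteq> \<Union>C"
    then obtain U where U: "U \<in> C" "x \<in> U" "open U" by auto
    show "\<exists>C'\<subseteq>C. finite C' \<and> {..x} \<subseteq> \<Union>C'"
    proof (cases "\<exists>a. a < x")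
      case True
      then obtain b where b: "b < x" "{b<..x} \<subseteq> U"
        using open_left[OF U(3,2)] by blast
      have "{..b} \<subseteq> \<Union>C" using cov b(1) subset_trans[of "{..b}" "{..x}" "\<Union>C"] by simp
      then obtain D where D: "D \<subseteq> C" "finite D" "{..b} \<subseteq> \<Union>D"
        by (rule compactE[OF less[OF b(1)]]) (use op in blast)
      have "{..x} \<subseteq> \<Union>(insert U D)"
      proof
        fix y assume "y \<in> {..x}"
        then show "y \<in> \<Union>(insert U D)"
          using b D(3) by (cases "y \<le> b") auto
      qed
      with D U(1) show ?thesis by (intro exI[of _ "insert U D"]) auto
    next
      case False
      then have "{..x} = {x}" by (auto simp: not_less intro: antisym)
      with U show ?thesis by (intro exI[of _ "{U}"]) auto
    qed
  qed
qed

lemma bcontfun_ordinal_interval: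
  "bcontfun = {f :: 'o::{wellorder, order_top, linorder_topology} \<Rightarrow> 'b::metric_space. continuous_on UNIV f}"
proof -
  have "(UNIV :: 'o set) = {..top}" by auto
  then have "compact (UNIV :: 'o set)" using compact_atMost_wellorder[of "top :: 'o"] by simp
  then show ?thesis
    by (auto simp: bcontfun_def intro: compact_imp_bounded compact_continuous_image)
qed

end

theory Submission
  imports Defs
begin

text \<open>
  Write \<open>X\<close> for the space of continuous functions from \<open>[0, \<Omega>]\<close> to \<open>E\<close>. It is enough to find, for
  each open cover, countably many locally finite families of nonnegative \<open>C\<^sup>k\<close> functions with
  supports subordinate to the cover, such that at each point of \<open>X\<close> some function does not vanish
  (\<open>partition_of_unity_from_sigma_locally_finite\<close>): one damps the \<open>n\<close>-th family where
  an earlier family is large, and normalises.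

  The functions on \<open>X\<close> are built from jumps. A continuous \<open>z\<close> on \<open>[0, \<Omega>]\<close> has, for each \<open>\<delta> > 0\<close>,
  only finitely many points \<open>\<gamma>\<close> at which it moves by at least \<open>\<delta>\<close> when passing to the successor of \<open>\<gamma>\<close>
  (\<open>finite_jumps\<close>), and these jumps control it: for \<open>\<delta>\<close> small enough, \<open>z\<close> oscillates
  by less than a given \<open>\<epsilon>\<close> on every interval that is not interrupted by a jump of size \<open>\<delta>\<close>
  (\<open>oscillation_between_jumps\<close>). So if \<open>F\<close> is the set of those jump points, then \<open>z\<close> is within \<open>\<epsilon>\<close> of
  the step function with value \<open>z \<alpha>\<close> at all points of \<open>[0, \<Omega>]\<close> whose next element of
  \<open>F \<union> {\<Omega>}\<close> is \<open>\<alpha>\<close>. For finite \<open>F\<close> and a choice \<open>\<sigma>\<close> of functions from a partition of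
  unity on \<open>E\<close> into small balls, the product of

  \<^item> the functions of \<open>z\<close> which detect a jump at \<open>\<gamma>\<close>, for \<open>\<gamma> \<in> F\<close>,
  \<^item> the functions \<open>\<sigma> \<alpha> (z \<alpha>)\<close> for \<open>\<alpha> \<in> F \<union> {\<Omega>}\<close>, and
  \<^item> a bump function which vanishes unless \<open>z\<close> is close to its step function for \<open>F\<close>

  is of class \<open>C\<^sup>k\<close> and is nonzero only on a set of small diameter. With the jump size and the ball size
  fixed, these products form a locally finite family: near a given function the first factor
  forces \<open>F\<close> into a finite set of jump points of that function, and the second leaves finitely many
  choices for each \<open>\<sigma> \<alpha>\<close>.

  The bump function is the delicate point, as the supremum norm of \<open>X\<close> need not be smooth. Let
  \<open>y\<close> be a continuous real function on \<open>[0, \<Omega>]\<close> with \<open>y \<Omega> = 0\<close>, and let \<open>\<gamma>'\<close> denote the successor of \<open>\<gamma>\<close>.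
  Consider the product over \<open>\<gamma>\<close> of \<open>h ((y \<gamma> - y \<gamma>') / (1 - y \<gamma>'))\<close>, where \<open>h\<close> is a smooth cutoff which
  is \<open>1\<close> near \<open>0\<close> and \<open>0\<close> near \<open>1\<close>. While \<open>y < 1\<close> everywhere, the denominators are bounded below, so
  that all but finitely many factors are \<open>1\<close>, even locally uniformly in \<open>y\<close>. If \<open>y\<close> reaches \<open>1\<close>, then
  at the last \<open>\<gamma>\<close> where \<open>y \<gamma> \<ge> 1\<close> the quotient is at least \<open>1\<close>, and the product vanishes near \<open>y\<close>.
  Hence the product is smooth, whatever the size of the last jump (\<open>ordinal_bump\<close>).

  In order to have these constructions available for \<open>C_k\<close>, its closure properties are first derived
  from the definition by multilinear derivatives. An induction on the order of differentiability
  over spaces of linear maps would change the type at each step; it is run instead over families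
  of \<open>j\<close>-linear forms in list arguments, with \<open>j\<close> varying.
\<close>

section \<open>Differentiability of form-valued maps\<close>

text \<open>
  Taking the derivative to be the Frechet derivative of each evaluation, instead of asserting that some
  derivative exists, makes all differentiability conditions pointwise. They can then be glued
  over open covers with no choice of derivatives.
\<close>
definition dform :: "('a::real_normed_vector \<Rightarrow> 'a list \<Rightarrow> 'b::real_normed_vector) \<Rightarrow> 'a \<Rightarrow> 'a list \<Rightarrow> 'b"
  where "dform A x vs = frechet_derivative (\<lambda>y. A y (tl vs)) (at x) (hd vs)"

definition cont_form ::
    "'a::real_normed_vector set \<Rightarrow> nat \<Rightarrow> ('a \<Rightarrow> 'a list \<Rightarrow> 'b::real_normed_vector) \<Rightarrow> bool"
  where "cont_form S j A \<longleftrightarrow>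
    (\<forall>x\<in>S. \<forall>e>0. \<forall>\<^sub>F y in nhds x. multilin_bound j (\<lambda>vs. A y vs - A x vs) e)"

definition deriv_form ::
    "'a::real_normed_vector set \<Rightarrow> nat \<Rightarrow> ('a \<Rightarrow> 'a list \<Rightarrow> 'b::real_normed_vector) \<Rightarrow>
      ('a \<Rightarrow> 'a list \<Rightarrow> 'b) \<Rightarrow> bool"
  where "deriv_form S j A A' \<longleftrightarrow>
    (\<forall>x\<in>S. \<forall>e>0. \<forall>\<^sub>F y in nhds x.
      multilin_bound j (\<lambda>vs. A y vs - A x vs - A' x ((y - x) # vs)) (e * norm (y - x)))"

text \<open>
  \<open>A\<close> is \<open>r\<close> times continuously differentiable on \<open>S\<close> as a map into the bounded \<open>j\<close>-linear forms.
\<close>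
primrec ck_form ::
    "nat \<Rightarrow> 'a::real_normed_vector set \<Rightarrow> nat \<Rightarrow> ('a \<Rightarrow> 'a list \<Rightarrow> 'b::real_normed_vector) \<Rightarrow> bool"
  where
    "ck_form 0 S j A \<longleftrightarrow> (\<forall>x\<in>S. bounded_multilinear j (A x)) \<and> cont_form S j A"
  | "ck_form (Suc r) S j A \<longleftrightarrow> (\<forall>x\<in>S. bounded_multilinear j (A x)) \<and>
      deriv_form S j A (dform A) \<and> ck_form r S (Suc j) (dform A)"

lemma ck_form_multilinear: "ck_form r S j A \<Longrightarrow> x \<in> S \<Longrightarrow> bounded_multilinear j (A x)"
  by (cases r) auto

lemma multilin_bound_cong:
  "(\<And>vs. length vs = j \<Longrightarrow> A vs = B vs) \<Longrightarrow> multilin_bound j A K = multilin_bound j B K"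
  by (auto simp: multilin_bound_def)

lemma bounded_multilinear_cong:
  assumes "\<And>vs. length vs = j \<Longrightarrow> A vs = B vs"
  shows "bounded_multilinear j A = bounded_multilinear j B"
proof -
  have "multilin_bound j A = multilin_bound j B"
    using multilin_bound_cong[of j A B] assms by blast
  then show ?thesis unfolding bounded_multilinear_def using assms by simp
qed

lemma bounded_multilinear_bound:
  assumes "bounded_multilinear j A"
  obtains K where "K > 0" "multilin_bound j A K"
proof -
  obtain K where "multilin_bound j A K" using assms by (auto simp: bounded_multilinear_def)
  then have "multilin_bound j A (max K 1)" by (rule multilin_bound_mono) simp
  then show ?thesis by (intro that[of "max K 1"]) auto
qed

lemma bounded_multilinear_hd:
  assumes "bounded_multilinear (Suc j) A" "length vs = j"
  shows "bounded_linear (\<lambda>h. A (h # vs))"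
proof -
  obtain K where "multilin_bound (Suc j) A K"
    using assms(1) by (auto simp: bounded_multilinear_def)
  then have K: "norm (A (h # vs)) \<le> norm h * (K * prod_list (map norm vs))" for h
    using assms(2) by (auto simp: multilin_bound_def algebra_simps dest!: spec[of _ "h # vs"])
  have "linear (\<lambda>h. A ((0 # vs)[0 := h]))"
    using assms unfolding bounded_multilinear_def by (metis length_Cons zero_less_Suc)
  then show ?thesis
    using K by (intro bounded_linear_intro[of _ "K * prod_list (map norm vs)"]) (auto simp: linear_iff)
qed

text \<open>
  Evaluation at a fixed list is continuous for the norm of forms, so it preserves derivatives. This
  is what makes derivatives of form-valued maps unique.
\<close>
lemma deriv_form_has_derivative:
  assumes "deriv_form S j A A'" "bounded_multilinear (Suc j) (A' x)" "x \<in> S" "length vs = j"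
  shows "((\<lambda>y. A y vs) has_derivative (\<lambda>h. A' x (h # vs))) (at x)"
  unfolding has_derivative_at_alt
proof (intro conjI allI impI bounded_multilinear_hd[OF assms(2,4)])
  fix e :: real assume e: "e > 0"
  define p where "p = prod_list (map norm vs)"
  have p: "p \<ge> 0" by (simp add: p_def prod_list_norm_nonneg)
  have e': "e / (p + 1) > 0" using e p by simp
  have "\<forall>\<^sub>F y in nhds x. norm (A y vs - A x vs - A' x ((y - x) # vs)) \<le> e * norm (y - x)"
  proof (rule eventually_mono)
    show "\<forall>\<^sub>F y in nhds x.
      multilin_bound j (\<lambda>vs. A y vs - A x vs - A' x ((y - x) # vs)) (e / (p + 1) * norm (y - x))"
      using assms(1,3) e' unfolding deriv_form_def by blast
    fix y
    assume "multilin_bound j (\<lambda>vs. A y vs - A x vs - A' x ((y - x) # vs)) (e / (p + 1) * norm (y - x))"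
    then have "norm (A y vs - A x vs - A' x ((y - x) # vs)) \<le> e / (p + 1) * norm (y - x) * p"
      using assms(4) by (auto simp: multilin_bound_def p_def)
    also have "\<dots> = (p / (p + 1)) * (e * norm (y - x))" by simp
    also have "\<dots> \<le> 1 * (e * norm (y - x))"
      using p e by (intro mult_right_mono) auto
    finally show "norm (A y vs - A x vs - A' x ((y - x) # vs)) \<le> e * norm (y - x)" by simp
  qed
  then show "\<exists>d>0. \<forall>y. norm (y - x) < d \<longrightarrow>
      norm (A y vs - A x vs - A' x ((y - x) # vs)) \<le> e * norm (y - x)"
    by (auto simp: eventually_nhds_metric dist_norm)
qed

lemma dform_eq:
  assumes "deriv_form S j A A'" "bounded_multilinear (Suc j) (A' x)" "x \<in> S" "length vs = Suc j"
  shows "dform A x vs = A' x vs"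
proof -
  obtain h us where "vs = h # us" "length us = j" using assms(4) by (auto simp: length_Suc_conv)
  then show ?thesis
    using frechet_derivative_at[OF deriv_form_has_derivative[OF assms(1-3)], of us]
    by (metis dform_def list.sel(1,3))
qed

lemma dform_cong:
  assumes "open S" "x \<in> S" "\<And>y vs. y \<in> S \<Longrightarrow> length vs = j \<Longrightarrow> A y vs = B y vs" "length vs = Suc j"
  shows "dform A x vs = dform B x vs"
proof -
  have "((\<lambda>y. A y (tl vs)) has_derivative f') (at x) \<longleftrightarrow>
      ((\<lambda>y. B y (tl vs)) has_derivative f') (at x)" for f'
    using assms by (auto intro: has_derivative_transform_within_open[of _ _ x UNIV S])
  then show ?thesis by (simp add: dform_def frechet_derivative_def)
qed

lemma ck_form_cong:
  assumes "ck_form r S j A" "open S" "\<And>y vs. y \<in> S \<Longrightarrow> length vs = j \<Longrightarrow> A y vs = B y vs"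
  shows "ck_form r S j B"
  using assms
proof (induction r arbitrary: j A B)
  case 0
  have "\<forall>\<^sub>F y in nhds x. multilin_bound j (\<lambda>vs. B y vs - B x vs) e" if "x \<in> S" "e > 0" for x e
  proof (rule eventually_rev_mp)
    show "\<forall>\<^sub>F y in nhds x. multilin_bound j (\<lambda>vs. A y vs - A x vs) e"
      using 0(1) that by (auto simp: cont_form_def)
    show "\<forall>\<^sub>F y in nhds x. multilin_bound j (\<lambda>vs. A y vs - A x vs) e \<longrightarrow>
        multilin_bound j (\<lambda>vs. B y vs - B x vs) e"
      using eventually_nhds_in_open[OF 0(2) that(1)]
      by (rule eventually_mono) (use 0(3) that in \<open>auto simp: multilin_bound_def\<close>)
  qed
  moreover have "bounded_multilinear j (B x)" if "x \<in> S" for x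
    using 0 that bounded_multilinear_cong[of j "A x" "B x"] by auto
  ultimately show ?case by (simp add: cont_form_def)
next
  case (Suc r)
  have d: "dform A x vs = dform B x vs" if "x \<in> S" "length vs = Suc j" for x vs
    by (rule dform_cong[OF Suc.prems(2) that(1) Suc.prems(3) that(2)])
  have "\<forall>\<^sub>F y in nhds x. multilin_bound j (\<lambda>vs. B y vs - B x vs - dform B x ((y - x) # vs))
      (e * norm (y - x))" if "x \<in> S" "e > 0" for x e
  proof (rule eventually_rev_mp)
    show "\<forall>\<^sub>F y in nhds x. multilin_bound j (\<lambda>vs. A y vs - A x vs - dform A x ((y - x) # vs))
        (e * norm (y - x))"
      using Suc.prems(1) that by (auto simp: deriv_form_def)
    show "\<forall>\<^sub>F y in nhds x.
        multilin_bound j (\<lambda>vs. A y vs - A x vs - dform A x ((y - x) # vs)) (e * norm (y - x)) \<longrightarrow>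
        multilin_bound j (\<lambda>vs. B y vs - B x vs - dform B x ((y - x) # vs)) (e * norm (y - x))"
      using eventually_nhds_in_open[OF Suc.prems(2) that(1)]
      by (rule eventually_mono) (use Suc.prems(3) that d in \<open>auto simp: multilin_bound_def\<close>)
  qed
  moreover have "bounded_multilinear j (B x)" if "x \<in> S" for x
    using Suc.prems that bounded_multilinear_cong[of j "A x" "B x"] by auto
  moreover have "ck_form r S (Suc j) (dform B)"
    using Suc.IH[of "Suc j" "dform A" "dform B"] Suc.prems d by auto
  ultimately show ?case by (simp add: deriv_form_def)
qed

text \<open>
  Any candidate for the derivative may be used, as it must agree with the canonical one on
  lists of the right length.
\<close>
lemma ck_form_SucI:
  assumes "open S" "\<And>x. x \<in> S \<Longrightarrow> bounded_multilinear j (A x)"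
    and "deriv_form S j A A'" "ck_form r S (Suc j) A'"
  shows "ck_form (Suc r) S j A"
proof -
  have eq: "A' x vs = dform A x vs" if "x \<in> S" "length vs = Suc j" for x vs
    using dform_eq[OF assms(3) ck_form_multilinear[OF assms(4)]] that by auto
  have "deriv_form S j A (dform A)"
    unfolding deriv_form_def
  proof (intro ballI allI impI)
    fix x and e :: real assume x: "x \<in> S" and e: "e > 0"
    have "multilin_bound j (\<lambda>vs. A y vs - A x vs - dform A x ((y - x) # vs)) (e * norm (y - x)) =
        multilin_bound j (\<lambda>vs. A y vs - A x vs - A' x ((y - x) # vs)) (e * norm (y - x))" for y
      by (rule multilin_bound_cong) (simp add: eq x)
    then show "\<forall>\<^sub>F y in nhds x.
        multilin_bound j (\<lambda>vs. A y vs - A x vs - dform A x ((y - x) # vs)) (e * norm (y - x))"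
      using assms(3) x e by (simp add: deriv_form_def)
  qed
  with assms eq show ?thesis by (auto intro: ck_form_cong)
qed

lemma multilin_bound_add:
  assumes "multilin_bound j A K" "multilin_bound j B L"
  shows "multilin_bound j (\<lambda>vs. A vs + B vs) (K + L)"
  using assms unfolding multilin_bound_def
  by (auto simp: distrib_right intro: norm_triangle_mono)

lemma deriv_form_imp_cont_form:
  assumes "deriv_form S j A A'" "\<And>x. x \<in> S \<Longrightarrow> bounded_multilinear (Suc j) (A' x)"
  shows "cont_form S j A"
  unfolding cont_form_def
proof (intro ballI allI impI)
  fix x and e :: real assume x: "x \<in> S" and e: "e > 0"
  obtain K where K: "K > 0" "multilin_bound (Suc j) (A' x) K"
    using bounded_multilinear_bound[OF assms(2)[OF x]] .
  have "\<forall>\<^sub>F y in nhds x. dist y x < e / (1 + K)"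
    using e K by (intro eventually_nhds_metric[THEN iffD2]) (auto intro!: exI[of _ "e / (1 + K)"])
  moreover have "\<forall>\<^sub>F y in nhds x.
      multilin_bound j (\<lambda>vs. A y vs - A x vs - A' x ((y - x) # vs)) (1 * norm (y - x))"
    using assms(1) x unfolding deriv_form_def using zero_less_one by blast
  ultimately show "\<forall>\<^sub>F y in nhds x. multilin_bound j (\<lambda>vs. A y vs - A x vs) e"
  proof eventually_elim
    case (elim y)
    have "multilin_bound j (\<lambda>vs. A' x ((y - x) # vs)) (K * norm (y - x))"
      using K(2) by (auto simp: multilin_bound_def mult.assoc dest: spec[of _ "(y - x) # _"])
    from multilin_bound_add[OF elim(2) this]
    have "multilin_bound j (\<lambda>vs. A y vs - A x vs) (1 * norm (y - x) + K * norm (y - x))" by simp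
    then show ?case
      by (rule multilin_bound_mono) (use elim(1) K in \<open>simp add: dist_norm field_simps\<close>)
  qed
qed

lemma ck_form_SucD: "ck_form (Suc r) S j A \<Longrightarrow> ck_form r S j A"
proof (induction r arbitrary: j A)
  case 0 then show ?case by (auto intro!: deriv_form_imp_cont_form[of S j A "dform A"])
next
  case (Suc r) then show ?case by (metis ck_form.simps(2))
qed

lemma ck_form_mono: "ck_form r S j A \<Longrightarrow> q \<le> r \<Longrightarrow> ck_form q S j A"
  by (induction r) (auto simp: le_Suc_eq simp del: ck_form.simps dest: ck_form_SucD)

lemma ck_form_cont: "ck_form r S j A \<Longrightarrow> cont_form S j A"
  using ck_form_mono[of r S j A 0] by simp

lemma ck_form_subset: "ck_form r S j A \<Longrightarrow> T \<subseteq> S \<Longrightarrow> ck_form r T j A"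
  by (induction r arbitrary: j A) (auto simp: cont_form_def deriv_form_def)

lemma ck_form_local: "(\<And>x. x \<in> S \<Longrightarrow> \<exists>T. x \<in> T \<and> ck_form r T j A) \<Longrightarrow> ck_form r S j A"
proof (induction r arbitrary: j A)
  case 0 then show ?case unfolding ck_form.simps cont_form_def by blast
next
  case (Suc r)
  have "ck_form r S (Suc j) (dform A)"
    by (rule Suc.IH) (use Suc.prems in \<open>meson ck_form.simps(2)\<close>)
  with Suc.prems show ?case unfolding ck_form.simps deriv_form_def by blast
qed

definition C_k_on :: "'a::real_normed_vector set \<Rightarrow> enat \<Rightarrow> ('a \<Rightarrow> 'b::real_normed_vector) \<Rightarrow> bool"
  where "C_k_on S k f \<longleftrightarrow> (\<forall>r. enat r \<le> k \<longrightarrow> ck_form r S 0 (\<lambda>x _. f x))"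

lemma ck_form_iterated_dform:
  assumes "C_k_on S k f" "enat (r + j) \<le> k"
  shows "ck_form r S j ((dform ^^ j) (\<lambda>x _. f x))"
  using assms(2)
proof (induction j arbitrary: r)
  case 0 then show ?case using assms(1) by (simp add: C_k_on_def)
next
  case (Suc j)
  from Suc.IH[of "Suc r"] Suc.prems show ?case by simp
qed

text \<open>
  For \<open>k = \<infinity>\<close> one sequence of derivatives has to serve all finite orders at once; the iterates of
  the canonical derivative do so.
\<close>
lemma C_k_iff_C_k_on: "C_k k f \<longleftrightarrow> C_k_on UNIV k f"
proof
  assume "C_k k f"
  then obtain D where D0: "\<And>x. D 0 x [] = f x"
    and ml: "\<And>j x. enat j \<le> k \<Longrightarrow> bounded_multilinear j (D j x)"
    and der: "\<And>j. enat j < k \<Longrightarrow> deriv_form UNIV j (D j) (D (Suc j))"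
    and con: "\<And>j. enat j \<le> k \<Longrightarrow> cont_form UNIV j (D j)"
    unfolding C_k_def deriv_form_def cont_form_def by blast
  have "ck_form r UNIV j (D j)" if "enat (r + j) \<le> k" for r j
    using that
  proof (induction r arbitrary: j)
    case 0 then show ?case using ml con by simp
  next
    case (Suc r)
    have "enat j < k" using Suc.prems by (rule less_le_trans[rotated]) simp
    then show ?case
      using Suc ml der by (intro ck_form_SucI[where A' = "D (Suc j)"]) auto
  qed
  then show "C_k_on UNIV k f"
    unfolding C_k_on_def using ck_form_cong[of _ UNIV 0 "D 0" "\<lambda>x _. f x"] by (simp add: D0)
next
  assume f: "C_k_on UNIV k f"
  define D where "D j = (dform ^^ j) (\<lambda>x _. f x)" for j
  note D = ck_form_iterated_dform[OF f, folded D_def]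
  have "deriv_form UNIV j (D j) (D (Suc j))" if "enat j < k" for j
    using D[of 1 j] that by (simp add: D_def Suc_ile_eq)
  moreover have "bounded_multilinear j (D j x) \<and> cont_form UNIV j (D j)" if "enat j \<le> k" for j x
    using D[of 0 j] that by simp
  ultimately show "C_k k f"
    unfolding C_k_def deriv_form_def cont_form_def by (intro exI[of _ D]) (auto simp: D_def)
qed

lemma C_k_on_local:
  assumes "\<And>x. x \<in> S \<Longrightarrow> \<exists>T. x \<in> T \<and> C_k_on T k f"
  shows "C_k_on S k f"
  unfolding C_k_on_def
proof (intro allI impI)
  fix r assume "enat r \<le> k"
  then show "ck_form r S 0 (\<lambda>x _. f x)"
    using assms unfolding C_k_on_def by (intro ck_form_local) blast
qed

lemma C_k_on_subset: "C_k_on S k f \<Longrightarrow> T \<subseteq> S \<Longrightarrow> C_k_on T k f"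
  unfolding C_k_on_def using ck_form_subset by blast

lemma C_k_on_cong:
  assumes "C_k_on S k f" "open S" "\<And>x. x \<in> S \<Longrightarrow> f x = g x"
  shows "C_k_on S k g"
  using assms unfolding C_k_on_def by (auto intro: ck_form_cong)

lemma cont_form_0_iff: "cont_form S 0 (\<lambda>x _. f x) \<longleftrightarrow> (\<forall>x\<in>S. isCont f x)"
  for f :: "'a::real_normed_vector \<Rightarrow> 'b::real_normed_vector"
proof -
  have "(\<forall>e>0. \<forall>\<^sub>F y in nhds x. norm (f y - f x) \<le> e) \<longleftrightarrow> isCont f x" for x
  proof
    assume *: "\<forall>e>0. \<forall>\<^sub>F y in nhds x. norm (f y - f x) \<le> e"
    have "(f \<longlongrightarrow> f x) (nhds x)"
    proof (rule tendstoI)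
      fix e :: real assume "e > 0"
      then have "\<forall>\<^sub>F y in nhds x. norm (f y - f x) \<le> e / 2" using *[rule_format, of "e / 2"] by simp
      then show "\<forall>\<^sub>F y in nhds x. dist (f y) (f x) < e"
        by (rule eventually_mono) (use \<open>e > 0\<close> in \<open>simp add: dist_norm\<close>)
    qed
    then show "isCont f x" by (simp add: isCont_def tendsto_at_iff_tendsto_nhds)
  next
    assume "isCont f x"
    then have "(f \<longlongrightarrow> f x) (nhds x)" by (simp add: isCont_def tendsto_at_iff_tendsto_nhds)
    then have "\<forall>\<^sub>F y in nhds x. dist (f y) (f x) < e" if "e > 0" for e using that by (rule tendstoD)
    then show "\<forall>e>0. \<forall>\<^sub>F y in nhds x. norm (f y - f x) \<le> e"
      by (metis (mono_tags, lifting) dist_norm eventually_mono less_imp_le)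
  qed
  then show ?thesis by (simp add: cont_form_def multilin_bound_0)
qed

lemma C_k_on_isCont:
  fixes f :: "'a::real_normed_vector \<Rightarrow> 'b::real_normed_vector"
  assumes "C_k_on S k f" "x \<in> S"
  shows "isCont f x"
proof -
  have "ck_form 0 S 0 (\<lambda>x _. f x)"
    using assms(1) unfolding C_k_on_def by (metis zero_enat_def zero_le)
  then show ?thesis using assms(2) by (simp add: cont_form_0_iff)
qed

lemma C_k_imp_continuous: "C_k k f \<Longrightarrow> continuous_on UNIV f"
  unfolding C_k_iff_C_k_on by (blast intro: continuous_at_imp_continuous_on C_k_on_isCont)

section \<open>Sums and products\<close>

lemma bounded_multilinear_add:
  assumes "bounded_multilinear j A" "bounded_multilinear j B"
  shows "bounded_multilinear j (\<lambda>vs. A vs + B vs)"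
proof -
  have "linear (\<lambda>v. A (vs[i := v]) + B (vs[i := v]))" if "length vs = j" "i < j" for vs i
    using assms that by (intro linear_compose_add) (auto simp: bounded_multilinear_def)
  moreover have "\<exists>K. multilin_bound j (\<lambda>vs. A vs + B vs) K"
    using assms multilin_bound_add unfolding bounded_multilinear_def by metis
  ultimately show ?thesis unfolding bounded_multilinear_def by blast
qed

lemma ck_form_add:
  assumes "open S" "ck_form r S j A" "ck_form r S j B"
  shows "ck_form r S j (\<lambda>x vs. A x vs + B x vs)"
  using assms(2,3)
proof (induction r arbitrary: j A B)
  case 0
  have ml: "bounded_multilinear j (\<lambda>vs. A x vs + B x vs)" if "x \<in> S" for x
    using 0 that by (intro bounded_multilinear_add) auto
  have "\<forall>\<^sub>F y in nhds x. multilin_bound j (\<lambda>vs. A y vs + B y vs - (A x vs + B x vs)) e"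
    if "x \<in> S" "e > 0" for x e
  proof -
    have "e / 2 > 0" using that by simp
    then have "\<forall>\<^sub>F y in nhds x. multilin_bound j (\<lambda>vs. A y vs - A x vs) (e / 2)"
      "\<forall>\<^sub>F y in nhds x. multilin_bound j (\<lambda>vs. B y vs - B x vs) (e / 2)"
      using 0 that(1) unfolding ck_form.simps cont_form_def by blast+
    then show ?thesis
    proof eventually_elim
      case (elim y)
      from multilin_bound_add[OF this] show ?case by (simp add: algebra_simps)
    qed
  qed
  with ml show ?case by (simp add: cont_form_def)
next
  case (Suc r)
  have "\<forall>\<^sub>F y in nhds x. multilin_bound j (\<lambda>vs. A y vs + B y vs - (A x vs + B x vs)
      - (dform A x ((y - x) # vs) + dform B x ((y - x) # vs))) (e * norm (y - x))"
    if "x \<in> S" "e > 0" for x e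
  proof -
    have "e / 2 > 0" using that by simp
    then have "\<forall>\<^sub>F y in nhds x. multilin_bound j (\<lambda>vs. A y vs - A x vs - dform A x ((y - x) # vs))
        (e / 2 * norm (y - x))"
      "\<forall>\<^sub>F y in nhds x. multilin_bound j (\<lambda>vs. B y vs - B x vs - dform B x ((y - x) # vs))
        (e / 2 * norm (y - x))"
      using Suc.prems that(1) unfolding ck_form.simps deriv_form_def by blast+
    then show ?thesis
    proof eventually_elim
      case (elim y)
      from multilin_bound_add[OF this] show ?case by (simp add: algebra_simps)
    qed
  qed
  then have "deriv_form S j (\<lambda>x vs. A x vs + B x vs) (\<lambda>x vs. dform A x vs + dform B x vs)"
    by (simp add: deriv_form_def)
  moreover have "bounded_multilinear j (\<lambda>vs. A x vs + B x vs)" if "x \<in> S" for x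
    using Suc.prems that by (intro bounded_multilinear_add) auto
  ultimately show ?case
    using Suc assms(1)
    by (intro ck_form_SucI[where A' = "\<lambda>x vs. dform A x vs + dform B x vs"]) auto
qed

text \<open>
  The product of two forms in which the first takes the arguments at the positions in \<open>I\<close> and the
  second takes the others. In the Leibniz rule the new argument, which stands in front, goes to one
  of the factors. Iterating it distributes the arguments in all possible ways, so sums of
  such products are closed under differentiation.
\<close>
definition shuffle_product ::
    "nat set \<Rightarrow> ('a \<Rightarrow> 'a list \<Rightarrow> real) \<Rightarrow> ('a \<Rightarrow> 'a list \<Rightarrow> real) \<Rightarrow> 'a \<Rightarrow> 'a list \<Rightarrow> real"
  where "shuffle_product I A B x vs = A x (nths vs I) * B x (nths vs (- I))"

lemma prod_list_nths:
  fixes f :: "'a \<Rightarrow> real"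
  shows "prod_list (map f (nths vs I)) * prod_list (map f (nths vs (- I))) = prod_list (map f vs)"
proof (induction vs arbitrary: I)
  case (Cons v vs)
  have "{n. Suc n \<in> - I} = - {n. Suc n \<in> I}" by auto
  with Cons[of "{n. Suc n \<in> I}"] show ?case by (auto simp: nths_Cons algebra_simps)
qed simp

text \<open>
  A change of one argument reaches exactly one of the two factors, at some position \<open>m\<close> there;
  hence a shuffle product is linear in each argument.
\<close>
lemma nths_list_update:
  assumes "i < length vs"
  shows "\<exists>m. \<forall>v. nths (vs[i := v]) I = (if i \<in> I then (nths vs I)[m := v] else nths vs I) \<and>
      (i \<in> I \<longrightarrow> m < length (nths vs I))"
  using assms
proof (induction vs arbitrary: i I)
  case (Cons w vs)
  show ?case
  proof (cases i)
    case 0 then show ?thesis by (intro exI[of _ 0]) (auto simp: nths_Cons)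
  next
    case (Suc n)
    define I' where "I' = {n. Suc n \<in> I}"
    from Cons.IH[of n I'] Cons.prems Suc obtain m where
      m: "\<And>v. nths (vs[n := v]) I' = (if n \<in> I' then (nths vs I')[m := v] else nths vs I')"
      "n \<in> I' \<Longrightarrow> m < length (nths vs I')" by auto
    have "n \<in> I' \<longleftrightarrow> Suc n \<in> I" by (simp add: I'_def)
    then show ?thesis
      using m unfolding Suc
      by (intro exI[of _ "if 0 \<in> I then Suc m else m"]) (auto simp: nths_Cons simp flip: I'_def)
  qed
qed simp

lemma multilin_bound_shuffle:
  fixes A B :: "'a::real_normed_vector list \<Rightarrow> real"
  assumes "multilin_bound a A K" "multilin_bound b B L" "0 \<le> K"
    and len: "\<And>vs::'a list. length vs = j \<Longrightarrow> length (nths vs I) = a \<and> length (nths vs (- I)) = b"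
  shows "multilin_bound j (\<lambda>vs. A (nths vs I) * B (nths vs (- I))) (K * L)"
  unfolding multilin_bound_def
proof (intro allI impI)
  fix vs :: "'a list" assume "length vs = j"
  note l = len[OF this]
  have "norm (A (nths vs I) * B (nths vs (- I))) \<le>
      (K * prod_list (map norm (nths vs I))) * (L * prod_list (map norm (nths vs (- I))))"
    unfolding norm_mult using assms l
    by (intro mult_mono) (auto simp: multilin_bound_def prod_list_norm_nonneg)
  also have "\<dots> = K * L * prod_list (map norm vs)"
    by (simp flip: prod_list_nths[of norm vs I])
  finally show "norm (A (nths vs I) * B (nths vs (- I))) \<le> K * L * prod_list (map norm vs)" .
qed

lemma bounded_multilinear_shuffle:
  fixes A B :: "'a::real_normed_vector list \<Rightarrow> real"
  assumes "bounded_multilinear a A" "bounded_multilinear b B"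
    and len: "\<And>vs::'a list. length vs = j \<Longrightarrow> length (nths vs I) = a \<and> length (nths vs (- I)) = b"
  shows "bounded_multilinear j (\<lambda>vs. A (nths vs I) * B (nths vs (- I)))"
proof -
  have "linear (\<lambda>v. A (nths (vs[i := v]) I) * B (nths (vs[i := v]) (- I)))"
    if vs: "length vs = j" "i < j" for vs i
  proof -
    obtain m where m: "\<And>v. nths (vs[i := v]) I = (if i \<in> I then (nths vs I)[m := v] else nths vs I)"
      "i \<in> I \<Longrightarrow> m < length (nths vs I)"
      using nths_list_update[of i vs I] vs by blast
    obtain n where n: "\<And>v. nths (vs[i := v]) (- I) =
        (if i \<in> - I then (nths vs (- I))[n := v] else nths vs (- I))"
      "i \<in> - I \<Longrightarrow> n < length (nths vs (- I))"
      using nths_list_update[of i vs "- I"] vs by blast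
    show ?thesis
    proof (cases "i \<in> I")
      case True
      then have "linear (\<lambda>v. A ((nths vs I)[m := v]))"
        using assms(1) m(2) len[OF vs(1)] unfolding bounded_multilinear_def by metis
      then show ?thesis using True by (simp add: m(1) n(1) linear_iff algebra_simps)
    next
      case False
      then have "linear (\<lambda>v. B ((nths vs (- I))[n := v]))"
        using assms(2) n(2) len[OF vs(1)] unfolding bounded_multilinear_def by (metis ComplI)
      then show ?thesis using False by (simp add: m(1) n(1) linear_iff algebra_simps)
    qed
  qed
  moreover
  obtain K L where KL: "K > 0" "multilin_bound a A K" "L > 0" "multilin_bound b B L"
    using bounded_multilinear_bound assms(1,2) by metis
  have "multilin_bound j (\<lambda>vs. A (nths vs I) * B (nths vs (- I))) (K * L)"
    using multilin_bound_shuffle[OF KL(2,4) _ len] KL by simp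
  ultimately show ?thesis unfolding bounded_multilinear_def by blast
qed

text \<open>
  The error estimate behind the product rule, with \<open>A2\<close>, \<open>B2\<close> the values at a point at distance \<open>t\<close>
  and \<open>A'\<close>, \<open>B'\<close> the predicted increments. With \<open>t = 1\<close> and no increments it also yields continuity.
\<close>
lemma shuffle_difference_bound:
  fixes A B A2 B2 :: "'a::real_normed_vector list \<Rightarrow> real"
  assumes A: "multilin_bound a (\<lambda>vs. A2 vs - A vs - A' vs) (e * t)" "multilin_bound a A K"
      "multilin_bound a A' (K' * t)"
    and B: "multilin_bound b (\<lambda>vs. B2 vs - B vs - B' vs) (e * t)" "multilin_bound b B L"
      "multilin_bound b (\<lambda>vs. B2 vs - B vs) e"
    and pos: "0 \<le> e" "e \<le> 1" "0 \<le> t" "0 \<le> K" "0 \<le> K'" "0 \<le> L"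
    and len: "\<And>vs::'a list. length vs = j \<Longrightarrow> length (nths vs I) = a \<and> length (nths vs (- I)) = b"
  shows "multilin_bound j (\<lambda>vs. A2 (nths vs I) * B2 (nths vs (- I)) - A (nths vs I) * B (nths vs (- I))
      - (A' (nths vs I) * B (nths vs (- I)) + A (nths vs I) * B' (nths vs (- I))))
      (e * (K + K' + L + 1) * t)"
proof -
  note sh = multilin_bound_shuffle[OF _ _ _ len]
  \<comment> \<open>With \<open>R\<close> for remainders and \<open>\<Delta>\<close> for increments, the error is \<open>R A * B + R A * \<Delta> B + A\' * \<Delta> B + A * R B\<close>.\<close>
  have "multilin_bound j (\<lambda>vs.
      ((A2 (nths vs I) - A (nths vs I) - A' (nths vs I)) * B (nths vs (- I)) +
       (A2 (nths vs I) - A (nths vs I) - A' (nths vs I)) * (B2 (nths vs (- I)) - B (nths vs (- I)))) +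
      (A' (nths vs I) * (B2 (nths vs (- I)) - B (nths vs (- I))) +
       A (nths vs I) * (B2 (nths vs (- I)) - B (nths vs (- I)) - B' (nths vs (- I)))))
    ((e * t * L + e * t * e) + (K' * t * e + K * (e * t)))"
    using pos by (intro multilin_bound_add sh[OF A(1) B(2)] sh[OF A(1) B(3)] sh[OF A(3) B(3)]
        sh[OF A(2) B(1)]) auto
  then have "multilin_bound j (\<lambda>vs. A2 (nths vs I) * B2 (nths vs (- I)) - A (nths vs I) * B (nths vs (- I))
      - (A' (nths vs I) * B (nths vs (- I)) + A (nths vs I) * B' (nths vs (- I))))
      ((e * t * L + e * t * e) + (K' * t * e + K * (e * t)))"
    by (simp add: algebra_simps)
  moreover have "e * t * e \<le> e * t * 1" using pos by (intro mult_left_mono) auto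
  then have "(e * t * L + e * t * e) + (K' * t * e + K * (e * t)) \<le> e * (K + K' + L + 1) * t"
    by (simp add: algebra_simps)
  ultimately show ?thesis by (rule multilin_bound_mono)
qed

lemma multilin_bound_Cons:
  "multilin_bound (Suc j) A K \<Longrightarrow> multilin_bound j (\<lambda>vs. A (h # vs)) (K * norm h)"
  by (auto simp: multilin_bound_def mult.assoc dest: spec[of _ "h # _"])

lemma small_factor:
  fixes e M :: real
  assumes "e > 0" "M > 0"
  shows "\<exists>d>0. d \<le> 1 \<and> d * M \<le> e"
proof -
  have "min 1 (e / M) * M \<le> (e / M) * M" using assms by (intro mult_right_mono) auto
  then show ?thesis using assms by (intro exI[of _ "min 1 (e / M)"]) auto
qed

text \<open>
  Leibniz rule: after shifting the old positions by one, the new position \<open>0\<close> is given to the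
  first factor (\<open>insert 0\<close>) or to the second.
\<close>
lemma deriv_form_shuffle:
  fixes A B :: "'a::real_normed_vector \<Rightarrow> 'a list \<Rightarrow> real"
  assumes A: "deriv_form S a A A'" "\<And>x. x \<in> S \<Longrightarrow> bounded_multilinear a (A x)"
      "\<And>x. x \<in> S \<Longrightarrow> bounded_multilinear (Suc a) (A' x)"
    and B: "deriv_form S b B B'" "\<And>x. x \<in> S \<Longrightarrow> bounded_multilinear b (B x)" "cont_form S b B"
    and len: "\<And>vs::'a list. length vs = j \<Longrightarrow> length (nths vs I) = a \<and> length (nths vs (- I)) = b"
  shows "deriv_form S j (shuffle_product I A B)
    (\<lambda>x vs. shuffle_product (insert 0 (Suc ` I)) A' B x vs + shuffle_product (Suc ` I) A B' x vs)"
  unfolding deriv_form_def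
proof (intro ballI allI impI)
  fix x and e :: real assume x: "x \<in> S" and e: "e > 0"
  obtain K where K: "K > 0" "multilin_bound a (A x) K"
    using bounded_multilinear_bound[OF A(2)[OF x]] .
  obtain L where L: "L > 0" "multilin_bound b (B x) L"
    using bounded_multilinear_bound[OF B(2)[OF x]] .
  obtain K' where K': "K' > 0" "multilin_bound (Suc a) (A' x) K'"
    using bounded_multilinear_bound[OF A(3)[OF x]] .
  obtain d where d: "d > 0" "d \<le> 1" "d * (K + K' + L + 1) \<le> e"
    using small_factor[OF e, of "K + K' + L + 1"] K(1) K'(1) L(1) by auto
  have "\<forall>\<^sub>F y in nhds x.
      multilin_bound a (\<lambda>vs. A y vs - A x vs - A' x ((y - x) # vs)) (d * norm (y - x))"
    using A(1) x d(1) unfolding deriv_form_def by blast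
  moreover have "\<forall>\<^sub>F y in nhds x.
      multilin_bound b (\<lambda>vs. B y vs - B x vs - B' x ((y - x) # vs)) (d * norm (y - x))"
    using B(1) x d(1) unfolding deriv_form_def by blast
  moreover have "\<forall>\<^sub>F y in nhds x. multilin_bound b (\<lambda>vs. B y vs - B x vs) d"
    using B(3) x d(1) unfolding cont_form_def by blast
  ultimately show "\<forall>\<^sub>F y in nhds x. multilin_bound j
      (\<lambda>vs. shuffle_product I A B y vs - shuffle_product I A B x vs -
        (shuffle_product (insert 0 (Suc ` I)) A' B x ((y - x) # vs) +
         shuffle_product (Suc ` I) A B' x ((y - x) # vs))) (e * norm (y - x))"
  proof eventually_elim
    case (elim y)
    have I: "{n. n \<in> I} = I" "{n. n \<notin> I} = - I" "{n. Suc n \<in> Suc ` I} = I"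
      "{n. Suc n \<notin> Suc ` I} = - I" by auto
    from shuffle_difference_bound[OF elim(1) K(2) multilin_bound_Cons[OF K'(2)] elim(2) L(2) elim(3)
        _ d(2) _ _ _ _ len] d(1) K(1) K'(1) L(1)
    have "multilin_bound j (\<lambda>vs. A y (nths vs I) * B y (nths vs (- I)) -
         A x (nths vs I) * B x (nths vs (- I)) -
         (A' x ((y - x) # nths vs I) * B x (nths vs (- I)) +
          A x (nths vs I) * B' x ((y - x) # nths vs (- I)))) (d * (K + K' + L + 1) * norm (y - x))"
      by simp
    then have "multilin_bound j (\<lambda>vs. A y (nths vs I) * B y (nths vs (- I)) -
         A x (nths vs I) * B x (nths vs (- I)) -
         (A' x ((y - x) # nths vs I) * B x (nths vs (- I)) +
          A x (nths vs I) * B' x ((y - x) # nths vs (- I)))) (e * norm (y - x))"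
      by (rule multilin_bound_mono) (intro mult_right_mono d, simp)
    then show ?case
      by (simp add: shuffle_product_def nths_Cons I)
  qed
qed

lemma ck_form_shuffle:
  fixes A B :: "'a::real_normed_vector \<Rightarrow> 'a list \<Rightarrow> real"
  assumes "open S" "ck_form r S a A" "ck_form r S b B"
    and "\<And>vs::'a list. length vs = j \<Longrightarrow> length (nths vs I) = a \<and> length (nths vs (- I)) = b"
  shows "ck_form r S j (shuffle_product I A B)"
  using assms(2-)
proof (induction r arbitrary: a b j A B I)
  case 0
  have "multilin_bound j (\<lambda>vs. shuffle_product I A B y vs - shuffle_product I A B x vs) (d * (K + 0 + L + 1) * 1)"
    if "multilin_bound a (\<lambda>vs. A y vs - A x vs) d" "multilin_bound b (\<lambda>vs. B y vs - B x vs) d"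
      "multilin_bound a (A x) K" "multilin_bound b (B x) L" "K > 0" "L > 0" "0 < d" "d \<le> 1" for x y d K L
  proof -
    have *: "multilin_bound i (\<lambda>vs. 0) (0 * 1)" for i :: nat by (simp add: multilin_bound_def)
    have "multilin_bound a (\<lambda>vs. A y vs - A x vs - 0) (d * 1)"
      "multilin_bound b (\<lambda>vs. B y vs - B x vs - 0) (d * 1)" using that by auto
    from shuffle_difference_bound[OF this(1) that(3) * this(2) that(4,2) _ _ _ _ _ _ 0(3)]
    show ?thesis using that by (simp add: shuffle_product_def)
  qed
  note bd = this
  have "\<forall>\<^sub>F y in nhds x. multilin_bound j (\<lambda>vs. shuffle_product I A B y vs - shuffle_product I A B x vs) e"
    if x: "x \<in> S" and e: "e > 0" for x e
  proof -
    obtain K where K: "K > 0" "multilin_bound a (A x) K"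
      using bounded_multilinear_bound 0(1) x by (metis ck_form_multilinear)
    obtain L where L: "L > 0" "multilin_bound b (B x) L"
      using bounded_multilinear_bound 0(2) x by (metis ck_form_multilinear)
    obtain d where d: "d > 0" "d \<le> 1" "d * (K + L + 1) \<le> e"
      using small_factor[OF e, of "K + L + 1"] K(1) L(1) by auto
    have "\<forall>\<^sub>F y in nhds x. multilin_bound a (\<lambda>vs. A y vs - A x vs) d"
      "\<forall>\<^sub>F y in nhds x. multilin_bound b (\<lambda>vs. B y vs - B x vs) d"
      using 0(1,2) x d(1) unfolding ck_form.simps cont_form_def by blast+
    then show ?thesis
    proof eventually_elim
      case (elim y)
      from bd[OF this K(2) L(2) K(1) L(1) d(1,2)] show ?case
        by (rule multilin_bound_mono) (use d in simp)
    qed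
  qed
  moreover have "bounded_multilinear j (shuffle_product I A B x)" if "x \<in> S" for x
    unfolding shuffle_product_def[abs_def]
    by (rule bounded_multilinear_shuffle[of a _ b]) (use 0 that in auto)
  ultimately show ?case by (simp add: cont_form_def)
next
  case (Suc r)
  have I: "{n. n \<in> I} = I" "{n. n \<notin> I} = - I" "{n. Suc n \<in> Suc ` I} = I"
      "{n. Suc n \<notin> Suc ` I} = - I" by auto
  have A: "ck_form r S a A" "ck_form r S (Suc a) (dform A)"
    and B: "ck_form r S b B" "ck_form r S (Suc b) (dform B)"
    using Suc.prems(1,2) ck_form_SucD by auto
  show ?case
  proof (rule ck_form_SucI[OF assms(1)])
    show "bounded_multilinear j (shuffle_product I A B x)" if "x \<in> S" for x
      unfolding shuffle_product_def[abs_def]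
      by (rule bounded_multilinear_shuffle[of a _ b]) (use Suc that in auto)
    show "deriv_form S j (shuffle_product I A B)
      (\<lambda>x vs. shuffle_product (insert 0 (Suc ` I)) (dform A) B x vs +
        shuffle_product (Suc ` I) A (dform B) x vs)"
      using Suc.prems A B ck_form_cont[OF B(1)] ck_form_multilinear[OF A(2)]
      by (intro deriv_form_shuffle[of S a A _ b]) auto
    show "ck_form r S (Suc j) (\<lambda>x vs. shuffle_product (insert 0 (Suc ` I)) (dform A) B x vs +
        shuffle_product (Suc ` I) A (dform B) x vs)"
      using Suc.prems(3)
      by (intro ck_form_add[OF assms(1)] Suc.IH[OF A(2) B(1)] Suc.IH[OF A(1) B(2)])
        (auto simp: nths_Cons length_Suc_conv I)
  qed
qed

lemma C_k_on_mult:
  fixes f g :: "'a::real_normed_vector \<Rightarrow> real"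
  assumes "open S" "C_k_on S k f" "C_k_on S k g"
  shows "C_k_on S k (\<lambda>x. f x * g x)"
  unfolding C_k_on_def
proof (intro allI impI)
  fix r assume "enat r \<le> k"
  then have "ck_form r S 0 (shuffle_product {} (\<lambda>x _. f x) (\<lambda>x _. g x))"
    using assms by (intro ck_form_shuffle[of S r 0 _ 0]) (auto simp: C_k_on_def)
  then show "ck_form r S 0 (\<lambda>x _. f x * g x)" by (simp add: shuffle_product_def[abs_def])
qed

lemma C_k_on_add: "open S \<Longrightarrow> C_k_on S k f \<Longrightarrow> C_k_on S k g \<Longrightarrow> C_k_on S k (\<lambda>x. f x + g x)"
  unfolding C_k_on_def using ck_form_add[of S _ 0 "\<lambda>x _. f x" "\<lambda>x _. g x"] by simp

lemma C_k_on_const: "open S \<Longrightarrow> C_k_on S k (\<lambda>_. c)"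
proof -
  assume S: "open S"
  have z: "bounded_multilinear j (\<lambda>_. 0)" for j
    by (auto simp: bounded_multilinear_def multilin_bound_def linear_iff intro!: exI[of _ 0])
  have 0: "ck_form r S j (\<lambda>_ _. 0)" for r j
  proof (induction r arbitrary: j)
    case 0 then show ?case by (simp add: z cont_form_def multilin_bound_def prod_list_norm_nonneg)
  next
    case (Suc r) then show ?case using S z
      by (intro ck_form_SucI[where A' = "\<lambda>_ _. 0"])
        (auto simp: deriv_form_def multilin_bound_def prod_list_norm_nonneg)
  qed
  have c: "bounded_multilinear 0 (\<lambda>_. c)"
    by (auto simp: bounded_multilinear_def multilin_bound_0)
  have "ck_form r S 0 (\<lambda>_ _. c)" for r
  proof (cases r)
    case 0 then show ?thesis by (simp add: c cont_form_def multilin_bound_0)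
  next
    case (Suc q) then show ?thesis using S 0
      by (auto intro!: c ck_form_SucI[where A' = "\<lambda>_ _. 0"] simp: deriv_form_def multilin_bound_0 simp del: ck_form.simps)
  qed
  then show ?thesis by (simp add: C_k_on_def)
qed

lemma C_k_on_cmult: "open S \<Longrightarrow> C_k_on S k f \<Longrightarrow> C_k_on S k (\<lambda>x. c * f x)" for f :: "_ \<Rightarrow> real"
  by (intro C_k_on_mult C_k_on_const)

lemma C_k_on_diff:
  fixes f g :: "'a::real_normed_vector \<Rightarrow> real"
  shows "open S \<Longrightarrow> C_k_on S k f \<Longrightarrow> C_k_on S k g \<Longrightarrow> C_k_on S k (\<lambda>x. f x - g x)"
  using C_k_on_add[of S k f "\<lambda>x. (-1) * g x"] C_k_on_cmult[of S k g "-1"] by simp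

lemma C_k_on_sum:
  "open S \<Longrightarrow> (\<And>i. i \<in> I \<Longrightarrow> C_k_on S k (f i)) \<Longrightarrow> C_k_on S k (\<lambda>x. \<Sum>i\<in>I. f i x)"
  by (induction I rule: infinite_finite_induct) (auto simp: C_k_on_const C_k_on_add)

lemma C_k_on_prod:
  fixes f :: "'i \<Rightarrow> 'a::real_normed_vector \<Rightarrow> real"
  shows "open S \<Longrightarrow> (\<And>i. i \<in> I \<Longrightarrow> C_k_on S k (f i)) \<Longrightarrow> C_k_on S k (\<lambda>x. \<Prod>i\<in>I. f i x)"
  by (induction I rule: infinite_finite_induct) (auto simp: C_k_on_const C_k_on_mult)

section \<open>Composition with real functions and with linear maps\<close>

lemma deriv_form_0I:
  assumes "\<And>x. x \<in> S \<Longrightarrow> (f has_derivative (\<lambda>h. A' x [h])) (at x)"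
  shows "deriv_form S 0 (\<lambda>x _. f x) A'"
  unfolding deriv_form_def multilin_bound_0
proof (intro ballI allI impI)
  fix x and e :: real assume x: "x \<in> S" and e: "e > 0"
  from assms[OF x] e obtain d where "d > 0"
    "\<And>y. norm (y - x) < d \<Longrightarrow> norm (f y - f x - A' x [y - x]) \<le> e * norm (y - x)"
    unfolding has_derivative_at_alt by meson
  then show "\<forall>\<^sub>F y in nhds x. norm (f y - f x - A' x [y - x]) \<le> e * norm (y - x)"
    unfolding eventually_nhds_metric dist_norm by blast
qed

text \<open>
  \<open>G m\<close> is the \<open>m\<close>-th derivative of the outer function. The statement is about all of them at once,
  since the chain rule turns \<open>G m\<close> composed with \<open>f\<close> into a product that involves \<open>G (Suc m)\<close> composed with \<open>f\<close>,
  to which the induction hypothesis applies.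
\<close>
lemma ck_form_compose_real:
  fixes f :: "'a::real_normed_vector \<Rightarrow> real" and G :: "nat \<Rightarrow> real \<Rightarrow> real"
  assumes S: "open S" "f ` S \<subseteq> T"
    and der: "\<And>m t. enat m < k \<Longrightarrow> t \<in> T \<Longrightarrow> (G m has_real_derivative G (Suc m) t) (at t)"
    and con: "\<And>m t. enat m \<le> k \<Longrightarrow> t \<in> T \<Longrightarrow> isCont (G m) t"
    and "ck_form r S 0 (\<lambda>x _. f x)" "enat (r + m) \<le> k"
  shows "ck_form r S 0 (\<lambda>x _. G m (f x))"
  using assms(5,6)
proof (induction r arbitrary: m)
  case 0
  then have "isCont (\<lambda>x. G m (f x)) x" if "x \<in> S" for x
    using that S(2) by (intro isCont_o2[of _ f "G m"] con) (auto simp: cont_form_0_iff)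
  moreover have "bounded_multilinear 0 (\<lambda>_. G m (f x))" for x
    by (auto simp: bounded_multilinear_def multilin_bound_0)
  ultimately show ?case by (simp only: ck_form.simps cont_form_0_iff) blast
next
  case (Suc r)
  let ?f' = "dform (\<lambda>x _. f x)"
  have f: "ck_form r S 0 (\<lambda>x _. f x)" "ck_form r S (Suc 0) ?f'"
    using ck_form_SucD[OF Suc.prems(1)] Suc.prems(1) by auto
  have m: "enat m < k"
    using Suc.prems(2) by (rule less_le_trans[rotated]) simp
  show ?case
  proof (rule ck_form_SucI[OF S(1)])
    show "bounded_multilinear 0 (\<lambda>_. G m (f x))" for x
      by (auto simp: bounded_multilinear_def multilin_bound_0)
    show "deriv_form S 0 (\<lambda>x _. G m (f x)) (shuffle_product {} (\<lambda>x _. G (Suc m) (f x)) ?f')"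
    proof (rule deriv_form_0I)
      fix x assume x: "x \<in> S"
      have "(f has_derivative (\<lambda>h. ?f' x [h])) (at x)"
        using Suc.prems(1) x ck_form_multilinear[OF f(2) x]
        by (intro deriv_form_has_derivative[of S 0 "\<lambda>x _. f x"]) auto
      moreover have "(G m has_derivative (*) (G (Suc m) (f x))) (at (f x))"
        using der[OF m] S(2) x by (auto simp: has_field_derivative_def)
      ultimately have "((\<lambda>x. G m (f x)) has_derivative (\<lambda>h. G (Suc m) (f x) * ?f' x [h])) (at x)"
        by (rule has_derivative_compose)
      then show "((\<lambda>x. G m (f x)) has_derivative
          (\<lambda>h. shuffle_product {} (\<lambda>x _. G (Suc m) (f x)) ?f' x [h])) (at x)"
        by (simp add: shuffle_product_def)
    qed
    show "ck_form r S (Suc 0) (shuffle_product {} (\<lambda>x _. G (Suc m) (f x)) ?f')"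
      using Suc f by (intro ck_form_shuffle[OF S(1), of r 0 _ "Suc 0"]) (auto simp: nths_all)
  qed
qed

text \<open>
  On the real line a \<open>j\<close>-linear form is determined by its value at \<open>(1, \<dots>, 1)\<close>, which gives the
  ordinary derivatives of \<open>g\<close>.
\<close>
lemma C_k_on_compose_real:
  fixes f :: "'a::real_normed_vector \<Rightarrow> real" and g :: "real \<Rightarrow> real"
  assumes "open S" "C_k k g" "C_k_on S k f"
  shows "C_k_on S k (\<lambda>x. g (f x))"
proof -
  define D where "D m = (dform ^^ m) (\<lambda>t _. g t)" for m
  define G where "G m t = D m t (replicate m 1)" for m t
  note D = ck_form_iterated_dform[OF assms(2)[unfolded C_k_iff_C_k_on], folded D_def]
  have "(G m has_real_derivative G (Suc m) t) (at t)" if "enat m < k" for m t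
  proof -
    have D1: "ck_form 1 UNIV m (D m)" using D[of 1 m] that by (simp add: Suc_ile_eq)
    have D2: "deriv_form UNIV m (D m) (D (Suc m))" "bounded_multilinear (Suc m) (D (Suc m) t)"
      using D1 by (simp_all add: D_def)
    have "bounded_linear (\<lambda>h. D (Suc m) t (h # replicate m 1))"
      by (rule bounded_multilinear_hd[OF D2(2)]) simp
    then have "D (Suc m) t ((h *\<^sub>R 1) # replicate m 1) = h *\<^sub>R G (Suc m) t" for h
      using linear_simps(5)[of "\<lambda>h. D (Suc m) t (h # replicate m 1)" h 1]
      by (simp add: G_def)
    then have "(\<lambda>h. D (Suc m) t (h # replicate m 1)) = (*) (G (Suc m) t)"
      by (auto simp: mult.commute)
    then show ?thesis
      using deriv_form_has_derivative[OF D2, of "replicate m 1"]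
      by (simp add: has_field_derivative_def G_def[abs_def])
  qed
  moreover have "isCont (G m) t" if "enat m \<le> k" for m t
  proof -
    have "cont_form UNIV m (D m)" using D[of 0 m] that by simp
    have "\<forall>\<^sub>F y in nhds t. norm (G m y - G m t) \<le> e" if "e > 0" for e t
    proof (rule eventually_mono)
      show "\<forall>\<^sub>F y in nhds t. multilin_bound m (\<lambda>vs. D m y vs - D m t vs) e"
        using \<open>cont_form UNIV m (D m)\<close> that unfolding cont_form_def by blast
    next
      fix y assume "multilin_bound m (\<lambda>vs. D m y vs - D m t vs) e"
      then have "norm (D m y (replicate m 1) - D m t (replicate m 1)) \<le>
          e * prod_list (map norm (replicate m (1 :: real)))"
        unfolding multilin_bound_def by (metis length_replicate)
      then show "norm (G m y - G m t) \<le> e" by (simp add: G_def)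
    qed
    then have "cont_form UNIV 0 (\<lambda>x _. G m x)" by (simp add: cont_form_def multilin_bound_0)
    then show ?thesis by (simp add: cont_form_0_iff)
  qed
  moreover have "G 0 = g" by (simp add: G_def[abs_def] D_def)
  ultimately show ?thesis
    using assms(3) ck_form_compose_real[OF assms(1), of f UNIV k G _ 0] by (auto simp: C_k_on_def)
qed

lemma C_k_on_inverse:
  fixes f :: "'a::real_normed_vector \<Rightarrow> real"
  assumes "open S" "C_k_on S k f" "\<And>x. x \<in> S \<Longrightarrow> f x \<noteq> 0"
  shows "C_k_on S k (\<lambda>x. inverse (f x))"
proof -
  define G where "G m t = (-1) ^ m * fact m * inverse t ^ Suc m" for m and t :: real
  have "(G m has_real_derivative G (Suc m) t) (at t)" if "t \<noteq> 0" for m t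
    unfolding G_def using that
    by (rule DERIV_cong[OF DERIV_cmult[OF DERIV_power[OF DERIV_inverse]]]) (simp add: algebra_simps)
  then have d: "(G m has_real_derivative G (Suc m) t) (at t)" if "t \<in> - {0}" for m t using that by simp
  then have "isCont (G m) t" if "t \<in> - {0}" for m t using that DERIV_isCont by blast
  moreover have "G 0 t = inverse t" for t by (simp add: G_def)
  moreover have "f ` S \<subseteq> - {0}" using assms(3) by force
  ultimately show ?thesis
    using assms(2,3) d ck_form_compose_real[OF assms(1), of f "- {0}" k G _ 0]
    by (auto simp: C_k_on_def)
qed

lemma multilin_bound_linear:
  fixes L :: "'a::real_normed_vector \<Rightarrow> 'b::real_normed_vector"
    and A :: "'b list \<Rightarrow> 'c::real_normed_vector"
  assumes "multilin_bound j A K" "K \<ge> 0" "\<And>v. norm (L v) \<le> B * norm v" "B \<ge> 0"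
  shows "multilin_bound j (\<lambda>vs. A (map L vs)) (K * B ^ j)"
proof -
  have p: "prod_list (map norm (map L vs)) \<le> B ^ length vs * prod_list (map norm vs)" for vs :: "'a list"
  proof (induction vs)
    case (Cons v vs)
    have "norm (L v) * prod_list (map norm (map L vs)) \<le>
        (B * norm v) * (B ^ length vs * prod_list (map norm vs))"
      using assms(3,4) Cons by (intro mult_mono prod_list_norm_nonneg) auto
    then show ?case by (simp add: algebra_simps)
  qed simp
  show ?thesis
    unfolding multilin_bound_def
  proof (intro allI impI)
    fix vs :: "'a list" assume vs: "length vs = j"
    then have "norm (A (map L vs)) \<le> K * prod_list (map norm (map L vs))"
      using assms(1) by (simp add: multilin_bound_def del: map_map)
    also have "\<dots> \<le> K * (B ^ j * prod_list (map norm vs))"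
      using p[of vs] vs assms(2) by (intro mult_left_mono) auto
    finally show "norm (A (map L vs)) \<le> K * B ^ j * prod_list (map norm vs)" by simp
  qed
qed

lemma ck_form_compose_linear:
  fixes L :: "'a::real_normed_vector \<Rightarrow> 'b::real_normed_vector"
    and A :: "'b \<Rightarrow> 'b list \<Rightarrow> 'c::real_normed_vector"
  assumes L: "bounded_linear L" and "ck_form r UNIV j A"
  shows "ck_form r UNIV j (\<lambda>x vs. A (L x) (map L vs))"
proof -
  obtain B where B: "B > 0" "\<And>v. norm (L v) \<le> B * norm v"
    using bounded_linear.pos_bounded[OF L] by (metis mult.commute)
  interpret L: bounded_linear L by (rule L)
  have lim: "(L \<longlongrightarrow> L x) (nhds x)" for x
    using linear_continuous_at[OF L, of x] by (simp add: isCont_def tendsto_at_iff_tendsto_nhds)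
  have ev: "\<forall>\<^sub>F y in nhds x. P (L y)" if "\<forall>\<^sub>F y in nhds (L x). P y" for P x
    using that lim[of x] by (simp add: filterlim_iff)
  have ml: "bounded_multilinear j (\<lambda>vs. A (map L vs))" if A: "bounded_multilinear j A"
    for j and A :: "'b list \<Rightarrow> 'c"
  proof -
    obtain K where K: "K > 0" "multilin_bound j A K" using bounded_multilinear_bound[OF A] .
    have "multilin_bound j (\<lambda>vs. A (map L vs)) (K * B ^ j)"
      using K B by (intro multilin_bound_linear) auto
    moreover have "linear (\<lambda>v. A (map L (vs[i := v])))" if "length vs = j" "i < j"
      for vs :: "'a list" and i
    proof -
      have "linear (\<lambda>v. A ((map L vs)[i := v]))"
        using A that by (auto simp: bounded_multilinear_def)
      then show ?thesis by (simp add: map_update linear_iff L.add L.scaleR)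
    qed
    ultimately show ?thesis unfolding bounded_multilinear_def by blast
  qed
  show ?thesis
    using assms(2)
  proof (induction r arbitrary: j A)
    case 0
    have "\<forall>\<^sub>F y in nhds x. multilin_bound j (\<lambda>vs. A (L y) (map L vs) - A (L x) (map L vs)) e"
      if e: "e > 0" for x e
    proof -
      have e': "e / B ^ j > 0" using e B by simp
      then have "\<forall>\<^sub>F y in nhds (L x). multilin_bound j (\<lambda>vs. A y vs - A (L x) vs) (e / B ^ j)"
        using 0 by (auto simp: cont_form_def)
      from ev[OF this] show ?thesis
      proof eventually_elim
        case (elim y)
        from multilin_bound_linear[OF this _ B(2)] e' B(1) show ?case by simp
      qed
    qed
    with ml 0 show ?case by (simp add: cont_form_def)
  next
    case (Suc r)
    have "\<forall>\<^sub>F y in nhds x. multilin_bound j (\<lambda>vs. A (L y) (map L vs) - A (L x) (map L vs) -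
        dform A (L x) (map L ((y - x) # vs))) (e * norm (y - x))"
      if e: "e > 0" for x e
    proof -
      have e': "e / B ^ Suc j > 0" using e B by simp
      then have "\<forall>\<^sub>F y in nhds (L x). multilin_bound j
          (\<lambda>vs. A y vs - A (L x) vs - dform A (L x) ((y - L x) # vs)) (e / B ^ Suc j * norm (y - L x))"
        using Suc.prems unfolding ck_form.simps deriv_form_def by blast
      from ev[OF this] show ?thesis
      proof eventually_elim
        case (elim y)
        have "e / B ^ Suc j * norm (L y - L x) \<le> e / B ^ Suc j * (B * norm (y - x))"
          using B(2)[of "y - x"] e' by (intro mult_left_mono) (auto simp: L.diff)
        moreover have "e / B ^ Suc j * (B * norm (y - x)) \<ge> 0" using e B(1) by simp
        ultimately have "multilin_bound j (\<lambda>vs. A (L y) (map L vs) - A (L x) (map L vs) -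
            dform A (L x) ((L y - L x) # map L vs)) (e / B ^ Suc j * (B * norm (y - x)) * B ^ j)"
          using multilin_bound_linear[OF multilin_bound_mono[OF elim] _ B(2)] B(1)
          by (meson less_imp_le)
        moreover have "e / B ^ Suc j * (B * norm (y - x)) * B ^ j = e * norm (y - x)"
          using B(1) by (simp add: field_simps)
        ultimately show ?case by (simp only: L.diff list.map)
      qed
    qed
    then have "deriv_form UNIV j (\<lambda>x vs. A (L x) (map L vs)) (\<lambda>x vs. dform A (L x) (map L vs))"
      by (simp add: deriv_form_def)
    with ml Suc show ?case
      by (intro ck_form_SucI[where A' = "\<lambda>x vs. dform A (L x) (map L vs)"]) auto
  qed
qed

lemma C_k_compose_linear: "bounded_linear L \<Longrightarrow> C_k k f \<Longrightarrow> C_k k (\<lambda>x. f (L x))"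
  unfolding C_k_iff_C_k_on C_k_on_def
  using ck_form_compose_linear[of L _ 0 "\<lambda>x _. f x"] by blast

section \<open>From sigma-locally finite families to partitions of unity\<close>

definition locally_finite_supports :: "('a::topological_space \<Rightarrow> real) set \<Rightarrow> bool"
  where "locally_finite_supports \<Phi> \<longleftrightarrow>
    (\<forall>x. \<exists>U. open U \<and> x \<in> U \<and> finite {\<phi>\<in>\<Phi>. \<exists>y\<in>U. \<phi> y \<noteq> 0})"

lemma supp_sum_eq_sum:
  assumes "finite F" "F \<subseteq> \<Phi>" "\<And>i. i \<in> \<Phi> \<Longrightarrow> f i \<noteq> 0 \<Longrightarrow> i \<in> F"
  shows "supp_sum f \<Phi> = sum f F"
  unfolding supp_sum_def support_on_def using assms by (intro sum.mono_neutral_left) auto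

lemma C_k_supp_sum:
  fixes \<Phi> :: "('a::real_normed_vector \<Rightarrow> real) set"
  assumes "locally_finite_supports \<Phi>" "\<And>\<phi>. \<phi> \<in> \<Phi> \<Longrightarrow> C_k k \<phi>"
  shows "C_k k (\<lambda>x. supp_sum (\<lambda>\<phi>. \<phi> x) \<Phi>)"
  unfolding C_k_iff_C_k_on
proof (rule C_k_on_local)
  fix x :: 'a
  obtain U where U: "open U" "x \<in> U" "finite {\<phi>\<in>\<Phi>. \<exists>y\<in>U. \<phi> y \<noteq> 0}"
    using assms(1) unfolding locally_finite_supports_def by blast
  let ?F = "{\<phi>\<in>\<Phi>. \<exists>y\<in>U. \<phi> y \<noteq> 0}"
  have "C_k_on U k (\<lambda>x. \<Sum>\<phi>\<in>?F. \<phi> x)"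
    using U(1) assms(2) C_k_on_subset[of UNIV k _ U] by (intro C_k_on_sum) (auto simp: C_k_iff_C_k_on)
  moreover have "supp_sum (\<lambda>\<phi>. \<phi> y) \<Phi> = (\<Sum>\<phi>\<in>?F. \<phi> y)" if "y \<in> U" for y
    using U(3) that by (intro supp_sum_eq_sum) auto
  ultimately have "C_k_on U k (\<lambda>x. supp_sum (\<lambda>\<phi>. \<phi> x) \<Phi>)"
    using U(1) by (rule_tac C_k_on_cong) auto
  with U(2) show "\<exists>T. x \<in> T \<and> C_k_on T k (\<lambda>x. supp_sum (\<lambda>\<phi>. \<phi> x) \<Phi>)" by blast
qed

lemma finite_support_at:
  assumes "locally_finite_supports \<Phi>" shows "finite {\<phi>\<in>\<Phi>. \<phi> x \<noteq> 0}"
proof -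
  obtain U where "x \<in> U" "finite {\<phi>\<in>\<Phi>. \<exists>y\<in>U. \<phi> y \<noteq> 0}"
    using assms unfolding locally_finite_supports_def by blast
  then show ?thesis by (auto elim!: rev_finite_subset)
qed

lemma supp_sum_nonneg: "(\<And>\<phi>. \<phi> \<in> \<Phi> \<Longrightarrow> 0 \<le> \<phi> x) \<Longrightarrow> 0 \<le> supp_sum (\<lambda>\<phi>. \<phi> x) \<Phi>"
  for \<Phi> :: "('a \<Rightarrow> real) set"
  by (auto simp: supp_sum_def support_on_def intro: sum_nonneg)

lemma supp_sum_pos:
  fixes \<Phi> :: "('a::topological_space \<Rightarrow> real) set"
  assumes "locally_finite_supports \<Phi>" "\<And>\<phi>. \<phi> \<in> \<Phi> \<Longrightarrow> 0 \<le> \<phi> x" "\<phi> \<in> \<Phi>" "\<phi> x \<noteq> 0"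
  shows "0 < supp_sum (\<lambda>\<phi>. \<phi> x) \<Phi>"
  unfolding supp_sum_def support_on_def
  using finite_support_at[OF assms(1), of x] assms(2-4) by (intro sum_pos2[of _ \<phi>]) (auto simp: less_le)

text \<open>
  A partition of unity is a set of functions, so two indices with the same function would be counted
  only once. For this reason the sum is taken over the set; dividing by it is injective and
  creates no new coincidences.
\<close>
lemma partition_of_unity_normalise:
  fixes \<Phi> :: "('a::real_normed_vector \<Rightarrow> real) set"
  assumes lf: "locally_finite_supports \<Phi>"
    and \<Phi>: "\<And>\<phi>. \<phi> \<in> \<Phi> \<Longrightarrow> C_k k \<phi>" "\<And>\<phi> x. \<phi> \<in> \<Phi> \<Longrightarrow> 0 \<le> \<phi> x"
      "\<And>\<phi>. \<phi> \<in> \<Phi> \<Longrightarrow> \<exists>V\<in>\<V>. closure {x. \<phi> x \<noteq> 0} \<subseteq> V"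
    and pos: "\<And>x. \<exists>\<phi>\<in>\<Phi>. \<phi> x \<noteq> 0"
  shows "\<exists>\<Psi>. C_k_partition_of_unity k \<V> \<Psi>"
proof -
  define s where "s x = supp_sum (\<lambda>\<phi>. \<phi> x) \<Phi>" for x
  define N where "N \<phi> x = \<phi> x * inverse (s x)" for \<phi> :: "'a \<Rightarrow> real" and x
  have s: "s x > 0" for x
    unfolding s_def using pos[of x] supp_sum_pos[OF lf, of x] \<Phi>(2) by blast
  then have s0: "s x \<noteq> 0" for x by (metis less_irrefl)
  have N0: "N \<phi> x \<noteq> 0 \<longleftrightarrow> \<phi> x \<noteq> 0" for \<phi> x using s0 by (simp add: N_def)
  have "C_k_on UNIV k s"
    using C_k_supp_sum[OF lf \<Phi>(1)] by (simp add: s_def[abs_def] C_k_iff_C_k_on)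
  then have "C_k k (N \<phi>)" if "\<phi> \<in> \<Phi>" for \<phi>
    unfolding C_k_iff_C_k_on N_def using \<Phi>(1)[OF that] s0
    by (intro C_k_on_mult C_k_on_inverse) (auto simp: C_k_iff_C_k_on)
  moreover have "N \<phi> x \<ge> 0" if "\<phi> \<in> \<Phi>" for \<phi> x
    using \<Phi>(2)[OF that] s[of x] by (simp add: N_def)
  moreover have "\<exists>U. open U \<and> x \<in> U \<and> finite {\<psi>\<in>N ` \<Phi>. \<exists>y\<in>U. \<psi> y \<noteq> 0}" for x
  proof -
    obtain U where U: "open U" "x \<in> U" "finite {\<phi>\<in>\<Phi>. \<exists>y\<in>U. \<phi> y \<noteq> 0}"
      using lf unfolding locally_finite_supports_def by blast
    have "{\<psi>\<in>N ` \<Phi>. \<exists>y\<in>U. \<psi> y \<noteq> 0} \<subseteq> N ` {\<phi>\<in>\<Phi>. \<exists>y\<in>U. \<phi> y \<noteq> 0}"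
      using N0 by blast
    then have "finite {\<psi>\<in>N ` \<Phi>. \<exists>y\<in>U. \<psi> y \<noteq> 0}"
      by (rule finite_subset) (intro finite_imageI U(3))
    with U(1,2) show ?thesis by blast
  qed
  moreover have "supp_sum (\<lambda>\<psi>. \<psi> x) (N ` \<Phi>) = 1" for x
  proof -
    let ?F = "{\<phi>\<in>\<Phi>. \<phi> x \<noteq> 0}"
    have fin: "finite ?F" by (rule finite_support_at[OF lf])
    have inj: "inj_on N \<Phi>"
    proof (rule inj_onI)
      fix \<phi> \<psi> assume "N \<phi> = N \<psi>"
      then have "N \<phi> x = N \<psi> x" for x by simp
      then show "\<phi> = \<psi>" using s0 by (auto simp: N_def)
    qed
    have "supp_sum (\<lambda>\<psi>. \<psi> x) (N ` \<Phi>) = (\<Sum>\<psi>\<in>N ` ?F. \<psi> x)"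
      using fin by (intro supp_sum_eq_sum) (auto simp: N0)
    also have "\<dots> = (\<Sum>\<phi>\<in>?F. N \<phi> x)"
      by (subst sum.reindex) (auto intro: inj_on_subset[OF inj])
    also have "\<dots> = (\<Sum>\<phi>\<in>?F. \<phi> x) * inverse (s x)" by (simp add: N_def sum_distrib_right)
    also have "(\<Sum>\<phi>\<in>?F. \<phi> x) = s x"
      unfolding s_def using fin by (intro supp_sum_eq_sum[symmetric]) auto
    finally show ?thesis using s0 by simp
  qed
  ultimately have "C_k_partition_of_unity k \<V> (N ` \<Phi>)"
    unfolding C_k_partition_of_unity_def using \<Phi>(3) by (auto simp: N0)
  then show ?thesis by blast
qed

text \<open>
  Both thresholds lie below \<open>1\<close>, so that \<open>h\<close> vanishes on a neighbourhood of \<open>1\<close>.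
\<close>
definition cutoff :: "enat \<Rightarrow> (real \<Rightarrow> real) \<Rightarrow> bool"
  where "cutoff k h \<longleftrightarrow> C_k k h \<and> (\<forall>t. 0 \<le> h t) \<and>
    (\<forall>t. \<bar>t\<bar> \<le> 1/4 \<longrightarrow> h t = 1) \<and> (\<forall>t. 1/2 \<le> \<bar>t\<bar> \<longrightarrow> h t = 0)"

text \<open>
  Let \<open>s m\<close> be the sum of the \<open>m\<close>-th family. A function of the \<open>n\<close>-th family is multiplied by factors
  that vanish where \<open>n * s m \<ge> 1/2\<close> for some \<open>m < n\<close>. Near a point with \<open>s m > 0\<close> this kills all
  families of large index, and in the first family that does not vanish at a given point the
  factors are \<open>1\<close> there.
\<close>
lemma partition_of_unity_from_sigma_locally_finite:
  fixes \<Phi> :: "nat \<Rightarrow> ('a::real_normed_vector \<Rightarrow> real) set"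
  assumes h: "cutoff k h" and lf: "\<And>n. locally_finite_supports (\<Phi> n)"
    and \<Phi>: "\<And>n \<phi>. \<phi> \<in> \<Phi> n \<Longrightarrow> C_k k \<phi>" "\<And>n \<phi> x. \<phi> \<in> \<Phi> n \<Longrightarrow> 0 \<le> \<phi> x"
      "\<And>n \<phi>. \<phi> \<in> \<Phi> n \<Longrightarrow> \<exists>V\<in>\<V>. closure {x. \<phi> x \<noteq> 0} \<subseteq> V"
    and pos: "\<And>x. \<exists>n. \<exists>\<phi>\<in>\<Phi> n. \<phi> x \<noteq> 0"
  shows "\<exists>\<Psi>. C_k_partition_of_unity k \<V> \<Psi>"
proof -
  have hC: "C_k k h" and h0: "\<And>t. t \<ge> 1/2 \<Longrightarrow> h t = 0" and h1: "h 0 = 1"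
    and hn: "\<And>t. h t \<ge> 0" using h by (auto simp: cutoff_def)
  define s where "s n x = supp_sum (\<lambda>\<phi>. \<phi> x) (\<Phi> n)" for n x
  define M where "M n \<phi> x = \<phi> x * (\<Prod>m<n. h (real n * s m x))" for n and \<phi> :: "'a \<Rightarrow> real" and x
  define \<Psi> where "\<Psi> = (\<Union>n. M n ` \<Phi> n)"
  have sC: "C_k k (s n)" for n
    using C_k_supp_sum[OF lf \<Phi>(1)] by (simp add: s_def[abs_def])
  have sn: "s n x \<ge> 0" for n x unfolding s_def using \<Phi>(2) by (rule supp_sum_nonneg)
  have M0: "M n \<phi> x \<noteq> 0 \<Longrightarrow> \<phi> x \<noteq> 0" for n \<phi> x by (auto simp: M_def)
  show ?thesis
  proof (rule partition_of_unity_normalise[of \<Psi>])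
    show "C_k k \<phi>" if "\<phi> \<in> \<Psi>" for \<phi>
    proof -
      obtain n \<psi> where *: "\<psi> \<in> \<Phi> n" "\<phi> = M n \<psi>" using \<open>\<phi> \<in> \<Psi>\<close> unfolding \<Psi>_def by blast
      have "C_k_on UNIV k (\<lambda>x. h (real n * s m x))" for m
        by (rule C_k_on_compose_real[OF open_UNIV hC C_k_on_cmult[OF open_UNIV]])
          (rule sC[unfolded C_k_iff_C_k_on])
      then have "C_k_on UNIV k (\<lambda>x. \<psi> x * (\<Prod>m<n. h (real n * s m x)))"
        using \<Phi>(1)[OF *(1)] unfolding C_k_iff_C_k_on by (intro C_k_on_mult C_k_on_prod open_UNIV)
      then show ?thesis by (simp add: C_k_iff_C_k_on *(2) M_def[abs_def])
    qed
    show "0 \<le> \<phi> x" if "\<phi> \<in> \<Psi>" for \<phi> x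
      using that \<Phi>(2) hn by (auto simp: \<Psi>_def M_def intro!: mult_nonneg_nonneg prod_nonneg)
    show "\<exists>V\<in>\<V>. closure {x. \<phi> x \<noteq> 0} \<subseteq> V" if "\<phi> \<in> \<Psi>" for \<phi>
    proof -
      obtain n \<psi> where *: "\<psi> \<in> \<Phi> n" "\<phi> = M n \<psi>" using \<open>\<phi> \<in> \<Psi>\<close> unfolding \<Psi>_def by blast
      then have "closure {x. \<phi> x \<noteq> 0} \<subseteq> closure {x. \<psi> x \<noteq> 0}"
        using M0 by (intro closure_mono) auto
      with \<Phi>(3)[OF *(1)] show ?thesis by blast
    qed
    show "\<exists>\<phi>\<in>\<Psi>. \<phi> x \<noteq> 0" for x
    proof -
      define n where "n = (LEAST n. \<exists>\<phi>\<in>\<Phi> n. \<phi> x \<noteq> 0)"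
      obtain \<phi> where \<phi>: "\<phi> \<in> \<Phi> n" "\<phi> x \<noteq> 0"
        using LeastI_ex[OF pos[of x]] unfolding n_def by blast
      have "s m x = 0" if "m < n" for m
      proof -
        have "\<phi> x = 0" if "\<phi> \<in> \<Phi> m" for \<phi>
          using not_less_Least[OF \<open>m < n\<close>[unfolded n_def]] that by blast
        then show ?thesis by (auto simp: s_def supp_sum_def support_on_def intro!: sum.neutral)
      qed
      then have "M n \<phi> x = \<phi> x" by (simp add: M_def h1)
      with \<phi>(2) have "M n \<phi> x \<noteq> 0" by simp
      moreover have "M n \<phi> \<in> \<Psi>" unfolding \<Psi>_def using \<phi>(1) by blast
      ultimately show ?thesis by blast
    qed
    show "locally_finite_supports \<Psi>"
      unfolding locally_finite_supports_def
    proof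
      fix x
      obtain m \<phi> where "\<phi> \<in> \<Phi> m" "\<phi> x \<noteq> 0" using pos by blast
      then have c: "s m x > 0" unfolding s_def using supp_sum_pos[OF lf] \<Phi>(2) by blast
      obtain N0 :: nat where N0: "1 / s m x < real N0" using reals_Archimedean2 by blast
      define N where "N = max (Suc m) N0"
      have "1 / s m x \<le> real N" using N0 by (simp add: N_def)
      then have N: "m < N" "1 \<le> real N * s m x"
        using c by (auto simp: N_def field_simps)
      have "\<forall>n. \<exists>U. open U \<and> x \<in> U \<and> finite {\<phi>\<in>\<Phi> n. \<exists>y\<in>U. \<phi> y \<noteq> 0}"
        using lf unfolding locally_finite_supports_def by blast
      from choice[OF this] obtain U where U: "\<And>n. open (U n)" "\<And>n. x \<in> U n"
          "\<And>n. finite {\<phi>\<in>\<Phi> n. \<exists>y\<in>U n. \<phi> y \<noteq> 0}" by blast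
      define W where "W = {y. s m x / 2 < s m y} \<inter> (\<Inter>n<N. U n)"
      have "open {y. s m x / 2 < s m y}"
        using C_k_imp_continuous[OF sC] by (intro open_Collect_less continuous_intros) auto
      then have "open W" "x \<in> W" unfolding W_def using U c by auto
      moreover have "{\<phi>\<in>\<Psi>. \<exists>y\<in>W. \<phi> y \<noteq> 0} \<subseteq>
          (\<Union>n<N. M n ` {\<phi>\<in>\<Phi> n. \<exists>y\<in>U n. \<phi> y \<noteq> 0})"
      proof
        fix \<phi> assume "\<phi> \<in> {\<phi>\<in>\<Psi>. \<exists>y\<in>W. \<phi> y \<noteq> 0}"
        then obtain n \<psi> y where *: "\<psi> \<in> \<Phi> n" "\<phi> = M n \<psi>" "y \<in> W" "M n \<psi> y \<noteq> 0"
          by (auto simp: \<Psi>_def)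
        have "n < N"
        proof (rule ccontr)
          assume "\<not> n < N"
          then have n: "m < n" "real N \<le> real n" using N by auto
          have "1 / 2 \<le> real N * (s m x / 2)" using N by simp
          also have "\<dots> \<le> real n * s m y"
            using n *(3) c by (intro mult_mono) (auto simp: W_def)
          finally have "h (real n * s m y) = 0" by (rule h0)
          then have "(\<Prod>m<n. h (real n * s m y)) = 0" using n(1) by auto
          with *(4) show False by (simp add: M_def)
        qed
        then have "y \<in> U n" using *(3) by (auto simp: W_def)
        with * \<open>n < N\<close> M0[OF *(4)] show "\<phi> \<in> (\<Union>n<N. M n ` {\<phi>\<in>\<Phi> n. \<exists>y\<in>U n. \<phi> y \<noteq> 0})"
          by blast
      qed
      then have "finite {\<phi>\<in>\<Psi>. \<exists>y\<in>W. \<phi> y \<noteq> 0}"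
        using U(3) by (auto elim!: finite_subset)
      ultimately show "\<exists>U. open U \<and> x \<in> U \<and> finite {\<phi>\<in>\<Psi>. \<exists>y\<in>U. \<phi> y \<noteq> 0}" by blast
    qed
  qed
qed

section \<open>Continuous functions on an ordinal interval\<close>

text \<open>
  The successor ordinal, with the last point as its own successor; there is never a jump at the last point.
\<close>
definition next_point :: "'o::{wellorder, order_top} \<Rightarrow> 'o"
  where "next_point \<gamma> = (if \<gamma> = top then top else (LEAST \<eta>. \<gamma> < \<eta>))"

lemma next_point_greater: "\<gamma> < top \<Longrightarrow> \<gamma> < next_point \<gamma>"
  unfolding next_point_def by (auto intro: LeastI)

lemma next_point_le: "\<gamma> < \<eta> \<Longrightarrow> next_point \<gamma> \<le> \<eta>"
  unfolding next_point_def by (auto intro: Least_le)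

lemma compact_UNIV_wellorder: "compact (UNIV :: 'o::{wellorder, order_top, linorder_topology} set)"
proof -
  have "(UNIV :: 'o set) = {..top}" by auto
  then show ?thesis using compact_atMost_wellorder[of "top :: 'o"] by simp
qed

lemma closed_has_last:
  fixes S :: "'o::{wellorder, order_top, linorder_topology} set"
  assumes "closed S" "S \<noteq> {}"
  shows "\<exists>s\<in>S. \<forall>t\<in>S. t \<le> s"
proof -
  have "compact (UNIV \<inter> S)" by (rule compact_Int_closed[OF compact_UNIV_wellorder assms(1)])
  then show ?thesis using compact_attains_sup assms(2) by simp
qed

text \<open>
  Jump points of a fixed size cannot accumulate at \<open>\<beta>\<close>: by continuity \<open>z\<close> is nearly constant on some
  \<open>(b, \<beta>]\<close>, which is closed under successors below \<open>\<beta>\<close>. So only the points up to \<open>b\<close> remain, and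
  well-founded induction applies.
\<close>
lemma finite_jumps:
  fixes z :: "'o::{wellorder, order_top, linorder_topology} \<Rightarrow> 'm::metric_space"
  assumes z: "continuous_on UNIV z" and d: "d > 0"
  shows "finite {\<gamma>. d \<le> dist (z \<gamma>) (z (next_point \<gamma>))}"
proof -
  have "finite {\<gamma>. \<gamma> < \<beta> \<and> d \<le> dist (z \<gamma>) (z (next_point \<gamma>))}" for \<beta>
  proof (induction \<beta> rule: less_induct)
    case (less \<beta>)
    show ?case
    proof (cases "\<exists>a. a < \<beta>")
      case True
      define U where "U = {\<eta>. dist (z \<eta>) (z \<beta>) < d / 2}"
      have "open U" unfolding U_def using z by (intro open_Collect_less continuous_intros) auto
      moreover have "\<beta> \<in> U" using d by (simp add: U_def)
      ultimately obtain b where b: "b < \<beta>" "{b<..\<beta>} \<subseteq> U" using open_left True by metis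
      have "{\<gamma>. \<gamma> < \<beta> \<and> d \<le> dist (z \<gamma>) (z (next_point \<gamma>))} \<subseteq>
          insert b {\<gamma>. \<gamma> < b \<and> d \<le> dist (z \<gamma>) (z (next_point \<gamma>))}"
      proof safe
        fix \<gamma> assume \<gamma>: "\<gamma> < \<beta>" "d \<le> dist (z \<gamma>) (z (next_point \<gamma>))" "\<gamma> \<noteq> b"
        show "\<gamma> < b"
        proof (rule ccontr)
          assume "\<not> \<gamma> < b"
          then have "b < \<gamma>" using \<gamma>(3) by simp
          moreover have "\<gamma> < next_point \<gamma>" using \<gamma>(1) by (intro next_point_greater) (metis less_le_trans top_greatest)
          ultimately have "\<gamma> \<in> U" "next_point \<gamma> \<in> U" using b(2) \<gamma>(1) next_point_le[OF \<gamma>(1)] by auto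
          then have "dist (z \<gamma>) (z (next_point \<gamma>)) < d"
            unfolding U_def using dist_triangle_half_r[of "z \<beta>" "z \<gamma>" d "z (next_point \<gamma>)"]
            by (simp add: dist_commute)
          with \<gamma>(2) show False by simp
        qed
      qed
      then show ?thesis by (rule finite_subset) (use less[OF b(1)] in simp)
    next
      case False then show ?thesis by simp
    qed
  qed
  from this[of top] have "finite (insert top {\<gamma>. \<gamma> < top \<and> d \<le> dist (z \<gamma>) (z (next_point \<gamma>))})" by simp
  then show ?thesis by (rule finite_subset[rotated]) (auto simp: less_top)
qed

text \<open>
  Go down from \<open>\<beta>\<close> to the last point \<open>\<sigma>\<close> where \<open>z\<close> is at distance \<open>e/2\<close> or more from \<open>z \<beta>\<close>. There is a
  jump at \<open>\<sigma>\<close>, as the value at its successor is closer to \<open>z \<beta>\<close>. If \<open>d\<close> is at most the size of this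
  jump, then no interval free of jumps of size \<open>d\<close> crosses \<open>\<sigma>\<close>; above \<open>\<sigma>\<close> the function is close to \<open>z \<beta>\<close>, and below it the induction hypothesis applies. The descent stops
  because ordinals are well-founded.
\<close>
lemma oscillation_between_jumps:
  fixes z :: "'o::{wellorder, order_top, linorder_topology} \<Rightarrow> 'm::metric_space"
  assumes z: "continuous_on UNIV z" and e: "e > 0"
  shows "\<exists>d>0. \<forall>\<gamma> \<alpha>. \<gamma> \<le> \<alpha> \<longrightarrow> \<alpha> \<le> \<beta> \<longrightarrow>
    (\<forall>\<eta>. \<gamma> \<le> \<eta> \<and> \<eta> < \<alpha> \<longrightarrow> dist (z \<eta>) (z (next_point \<eta>)) < d) \<longrightarrow> dist (z \<gamma>) (z \<alpha>) < e"
proof (induction \<beta> rule: less_induct)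
  case (less \<beta>)
  define S where "S = {\<eta>. \<eta> \<le> \<beta> \<and> e / 2 \<le> dist (z \<eta>) (z \<beta>)}"
  have near: "dist (z \<gamma>) (z \<alpha>) < e" if "\<gamma> \<notin> S" "\<alpha> \<notin> S" "\<gamma> \<le> \<beta>" "\<alpha> \<le> \<beta>" for \<gamma> \<alpha>
    using that dist_triangle_half_r[of "z \<beta>" "z \<gamma>" e "z \<alpha>"] by (auto simp: S_def dist_commute)
  have "closed S" unfolding S_def using z
    by (intro closed_Collect_conj closed_Collect_le continuous_intros) auto
  show ?case
  proof (cases "S = {}")
    case True
    then show ?thesis using near by (intro exI[of _ 1]) auto
  next
    case False
    then obtain \<sigma> where \<sigma>: "\<sigma> \<in> S" "\<And>\<eta>. \<eta> \<in> S \<Longrightarrow> \<eta> \<le> \<sigma>"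
      using closed_has_last[OF \<open>closed S\<close>] by blast
    have "\<beta> \<notin> S" using e by (simp add: S_def)
    then have "\<sigma> < \<beta>" using \<sigma>(1) by (auto simp: S_def less_le)
    then obtain d where d: "d > 0" and IH: "\<And>\<gamma> \<alpha>. \<gamma> \<le> \<alpha> \<Longrightarrow> \<alpha> \<le> \<sigma> \<Longrightarrow>
        (\<And>\<eta>. \<gamma> \<le> \<eta> \<and> \<eta> < \<alpha> \<Longrightarrow> dist (z \<eta>) (z (next_point \<eta>)) < d) \<Longrightarrow> dist (z \<gamma>) (z \<alpha>) < e"
      using less.IH by metis
    have "\<sigma> < next_point \<sigma>" using \<open>\<sigma> < \<beta>\<close> by (intro next_point_greater) (metis less_le_trans top_greatest)
    then have "next_point \<sigma> \<notin> S" using \<sigma>(2) by force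
    then have "z \<sigma> \<noteq> z (next_point \<sigma>)"
      using \<sigma>(1) next_point_le[OF \<open>\<sigma> < \<beta>\<close>] by (auto simp: S_def)
    then have j: "dist (z \<sigma>) (z (next_point \<sigma>)) > 0" by simp
    show ?thesis
    proof (intro exI[of _ "min d (dist (z \<sigma>) (z (next_point \<sigma>)))"] conjI allI impI)
      fix \<gamma> \<alpha> assume *: "\<gamma> \<le> \<alpha>" "\<alpha> \<le> \<beta>"
        "\<forall>\<eta>. \<gamma> \<le> \<eta> \<and> \<eta> < \<alpha> \<longrightarrow> dist (z \<eta>) (z (next_point \<eta>)) < min d (dist (z \<sigma>) (z (next_point \<sigma>)))"
      consider "\<alpha> \<le> \<sigma>" | "\<sigma> < \<gamma>" | "\<gamma> \<le> \<sigma>" "\<sigma> < \<alpha>" by force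
      then show "dist (z \<gamma>) (z \<alpha>) < e"
      proof cases
        case 1 then show ?thesis using IH[of \<gamma> \<alpha>] * by auto
      next
        case 2 then show ?thesis using near[of \<gamma> \<alpha>] \<sigma>(2) * by force
      next
        case 3 then show ?thesis using *(3) by auto
      qed
    qed (use d j in auto)
  qed
qed

text \<open>
  Composing \<open>z\<close> with this map yields the step function that takes on each interval between consecutive
  points of \<open>F\<close> the value of \<open>z\<close> at the right end of the interval.
\<close>
definition next_in :: "'o::{wellorder, order_top} set \<Rightarrow> 'o \<Rightarrow> 'o"
  where "next_in F \<gamma> = (LEAST \<alpha>. \<gamma> \<le> \<alpha> \<and> (\<alpha> \<in> F \<or> \<alpha> = top))"

lemma next_in: "\<gamma> \<le> next_in F \<gamma>" "next_in F \<gamma> \<in> insert top F"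
proof -
  have "\<gamma> \<le> next_in F \<gamma> \<and> (next_in F \<gamma> \<in> F \<or> next_in F \<gamma> = top)"
    unfolding next_in_def by (rule LeastI[of _ top]) simp
  then show "\<gamma> \<le> next_in F \<gamma>" "next_in F \<gamma> \<in> insert top F" by auto
qed

lemma next_in_le: "\<gamma> \<le> \<alpha> \<Longrightarrow> \<alpha> \<in> insert top F \<Longrightarrow> next_in F \<gamma> \<le> \<alpha>"
  unfolding next_in_def by (rule Least_le) auto

lemma next_in_top [simp]: "next_in F top = top"
  using next_in(1)[of top F] by (simp add: top_unique)

text \<open>
  The sets where the map is constant are intervals \<open>(\<beta>, \<alpha>]\<close>, or \<open>[0, \<alpha>]\<close>, which are open in the order
  topology of ordinals.
\<close>
lemma next_in_locally_constant:
  fixes \<gamma> :: "'o::{wellorder, order_top, linorder_topology}"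
  assumes "finite F"
  shows "\<forall>\<^sub>F \<eta> in nhds \<gamma>. next_in F \<eta> = next_in F \<gamma>"
proof -
  define \<alpha> where "\<alpha> = next_in F \<gamma>"
  define W where "W = {\<eta>. \<eta> \<le> \<alpha>} \<inter> (\<Inter>f\<in>{f\<in>F. f < \<gamma>}. {f<..})"
  have "open {\<eta>. \<eta> \<le> \<alpha>}"
  proof (cases "\<alpha> = top")
    case False
    then have "\<alpha> < next_point \<alpha>" by (intro next_point_greater) (simp add: less_top)
    then have "{\<eta>. \<eta> \<le> \<alpha>} = {..<next_point \<alpha>}" using next_point_le by (force simp: not_less[symmetric])
    then show ?thesis by simp
  qed simp
  then have "open W" unfolding W_def using assms by (intro open_Int open_INT) auto
  moreover have "\<gamma> \<in> W" using next_in(1) by (auto simp: W_def \<alpha>_def)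
  moreover have "next_in F \<eta> = \<alpha>" if "\<eta> \<in> W" for \<eta>
  proof (rule antisym)
    show "next_in F \<eta> \<le> \<alpha>"
      using that next_in(2)[of F \<gamma>] by (intro next_in_le) (auto simp: W_def \<alpha>_def)
    show "\<alpha> \<le> next_in F \<eta>"
    proof (cases "\<gamma> \<le> next_in F \<eta>")
      case True
      then show ?thesis unfolding \<alpha>_def by (intro next_in_le next_in(2))
    next
      case False
      then have "next_in F \<eta> \<in> F" using next_in(2)[of F \<eta>] by auto
      with False that have "next_in F \<eta> < \<eta>" by (auto simp: W_def)
      with next_in(1)[of \<eta> F] show ?thesis by simp
    qed
  qed
  ultimately show ?thesis unfolding \<alpha>_def eventually_nhds by blast
qed

section \<open>Bump functions\<close>

text \<open>
  Collect those functions of a partition of unity subordinate to the unit ball and the complement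
  of the closed ball of radius \<open>1/2\<close> whose support lies in that complement.
\<close>
lemma C_k_separating_zero:
  assumes "admits_C_k_partitions_of_unity k TYPE('e::real_normed_vector)"
  shows "\<exists>u::'e \<Rightarrow> real. C_k k u \<and> (\<forall>x. 0 \<le> u x) \<and>
    (\<forall>x. norm x \<le> 1/2 \<longrightarrow> u x = 0) \<and> (\<forall>x. 1 \<le> norm x \<longrightarrow> u x = 1)"
proof -
  let ?V = "{ball 0 1, - cball 0 (1/2)} :: 'e set set"
  have "(\<forall>V\<in>?V. open V) \<and> \<Union>?V = UNIV" by (auto simp: open_Compl)
  then obtain \<Phi> where \<Phi>: "C_k_partition_of_unity k ?V \<Phi>"
    using assms unfolding admits_C_k_partitions_of_unity_def by blast
  define \<Phi>\<^sub>1 where "\<Phi>\<^sub>1 = {\<phi>\<in>\<Phi>. closure {x. \<phi> x \<noteq> 0} \<subseteq> - cball 0 (1/2)}"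
  define u where "u x = supp_sum (\<lambda>\<phi>. \<phi> x) \<Phi>\<^sub>1" for x
  have lf: "locally_finite_supports \<Phi>" and pC: "\<And>\<phi>. \<phi> \<in> \<Phi> \<Longrightarrow> C_k k \<phi>"
    and pn: "\<And>\<phi> x. \<phi> \<in> \<Phi> \<Longrightarrow> 0 \<le> \<phi> x"
    and pV: "\<And>\<phi>. \<phi> \<in> \<Phi> \<Longrightarrow> \<exists>V\<in>?V. closure {x. \<phi> x \<noteq> 0} \<subseteq> V"
    and p1: "\<And>x. supp_sum (\<lambda>\<phi>. \<phi> x) \<Phi> = 1"
    using \<Phi> unfolding C_k_partition_of_unity_def locally_finite_supports_def by blast+
  have "locally_finite_supports \<Phi>\<^sub>1"
    unfolding locally_finite_supports_def
  proof
    fix x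
    obtain U where U: "open U" "x \<in> U" "finite {\<phi>\<in>\<Phi>. \<exists>y\<in>U. \<phi> y \<noteq> 0}"
      using lf unfolding locally_finite_supports_def by blast
    have "finite {\<phi>\<in>\<Phi>\<^sub>1. \<exists>y\<in>U. \<phi> y \<noteq> 0}"
      by (rule finite_subset[OF _ U(3)]) (auto simp: \<Phi>\<^sub>1_def)
    with U show "\<exists>U. open U \<and> x \<in> U \<and> finite {\<phi>\<in>\<Phi>\<^sub>1. \<exists>y\<in>U. \<phi> y \<noteq> 0}" by blast
  qed
  then have "C_k k u"
    unfolding u_def[abs_def] by (rule C_k_supp_sum) (simp add: \<Phi>\<^sub>1_def pC)
  moreover have "u x \<ge> 0" for x
    unfolding u_def using pn by (intro supp_sum_nonneg) (simp add: \<Phi>\<^sub>1_def)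
  moreover have "u x = 0" if "norm x \<le> 1/2" for x
  proof -
    have "\<phi> x = 0" if "\<phi> \<in> \<Phi>\<^sub>1" for \<phi>
      using that \<open>norm x \<le> 1/2\<close> closure_subset[of "{x. \<phi> x \<noteq> 0}"] by (auto simp: \<Phi>\<^sub>1_def)
    then show ?thesis by (auto simp: u_def supp_sum_def support_on_def intro!: sum.neutral)
  qed
  moreover have "u x = 1" if "1 \<le> norm x" for x
  proof -
    let ?F = "{\<phi>\<in>\<Phi>. \<phi> x \<noteq> 0}"
    have F: "finite ?F" by (rule finite_support_at[OF lf])
    have *: "\<phi> \<in> \<Phi>\<^sub>1" if "\<phi> \<in> \<Phi>" "\<phi> x \<noteq> 0" for \<phi>
    proof -
      have "x \<in> closure {x. \<phi> x \<noteq> 0}"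
        by (rule subsetD[OF closure_subset]) (simp add: that(2))
      then have "\<not> closure {x. \<phi> x \<noteq> 0} \<subseteq> ball 0 1" using \<open>1 \<le> norm x\<close> by auto
      with pV[OF that(1)] that(1) show ?thesis by (auto simp: \<Phi>\<^sub>1_def)
    qed
    have "u x = (\<Sum>\<phi>\<in>?F. \<phi> x)"
      unfolding u_def using F * by (intro supp_sum_eq_sum) (auto simp: \<Phi>\<^sub>1_def)
    also have "\<dots> = supp_sum (\<lambda>\<phi>. \<phi> x) \<Phi>"
      using F by (intro supp_sum_eq_sum[symmetric]) auto
    finally show ?thesis by (simp add: p1)
  qed
  ultimately show ?thesis by blast
qed

text \<open>
  A cutoff on the real line, found by restricting the separating function on \<open>E\<close> to the line through \<open>a\<close>;
  the square makes it nonnegative.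
\<close>
lemma cutoff_exists:
  fixes u :: "'e::real_normed_vector \<Rightarrow> real" and a :: 'e
  assumes u: "C_k k u" "\<And>x. norm x \<le> 1/2 \<Longrightarrow> u x = 0" "\<And>x. 1 \<le> norm x \<Longrightarrow> u x = 1"
    and a: "a \<noteq> 0"
  shows "\<exists>h. cutoff k h"
proof -
  define L where "L t = t *\<^sub>R ((2 / norm a) *\<^sub>R a)" for t :: real
  have L: "norm (L t) = 2 * \<bar>t\<bar>" for t using a by (simp add: L_def)
  have "bounded_linear L" unfolding L_def[abs_def] by (rule bounded_linear_scaleR_left)
  then have "C_k k (\<lambda>t. u (L t))" using u(1) by (rule C_k_compose_linear)
  then have "C_k k (\<lambda>t. (1 - u (L t)) * (1 - u (L t)))"
    unfolding C_k_iff_C_k_on by (intro C_k_on_mult C_k_on_diff C_k_on_const open_UNIV)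
  then have "cutoff k (\<lambda>t. (1 - u (L t)) * (1 - u (L t)))"
    by (auto simp: cutoff_def u L)
  then show ?thesis by (rule exI[where P = "cutoff k"])
qed

text \<open>
  The parameter \<open>x\<close> enters only through a continuous real function \<open>y x\<close> on the interval that depends on
  \<open>x\<close> continuously in the supremum norm and, at each point of the interval, in a \<open>C\<^sup>k\<close> way. The product of the cutoffs
  of the quotients \<open>\<rho>\<close> separates the \<open>x\<close> for which \<open>y x\<close> is zero from those for which it reaches \<open>1\<close>.
\<close>
lemma ordinal_bump:
  fixes y :: "'x::real_normed_vector \<Rightarrow> 'o::{wellorder, order_top, linorder_topology} \<Rightarrow> real"
  assumes h: "cutoff k h"
    and yC: "\<And>\<gamma>. C_k k (\<lambda>x. y x \<gamma>)"
    and yc: "\<And>x. continuous_on UNIV (y x)"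
    and yu: "\<And>x e. e > 0 \<Longrightarrow> \<forall>\<^sub>F x' in nhds x. \<forall>\<gamma>. \<bar>y x' \<gamma> - y x \<gamma>\<bar> < e"
    and yt: "\<And>x. y x top = 0"
  shows "\<exists>b :: _ \<Rightarrow> real. C_k k b \<and> (\<forall>x. 0 \<le> b x) \<and> (\<forall>x \<gamma>. 1 \<le> y x \<gamma> \<longrightarrow> b x = 0) \<and>
    (\<forall>x. (\<forall>\<gamma>. y x \<gamma> = 0) \<longrightarrow> b x = 1)"
proof -
  have hC: "C_k k h" and h0: "\<And>t. t \<ge> 1/2 \<Longrightarrow> h t = 0" and h1: "\<And>t. \<bar>t\<bar> \<le> 1/4 \<Longrightarrow> h t = 1"
    and hn: "\<And>t. h t \<ge> 0" using h by (auto simp: cutoff_def)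
  define \<rho> where "\<rho> x \<gamma> = (y x \<gamma> - y x (next_point \<gamma>)) * inverse (1 - y x (next_point \<gamma>))" for x \<gamma>
  define b where "b x = (if \<exists>\<gamma>. 1 \<le> y x \<gamma> then 0 else \<Prod>\<gamma> | \<bar>\<rho> x \<gamma>\<bar> > 1/4. h (\<rho> x \<gamma>))" for x
  \<comment> \<open>While \<open>y x < 1\<close>, only a finite set of factors differs from \<open>1\<close>, locally uniformly in \<open>x\<close>.\<close>
  have below: "\<exists>S J. open S \<and> x \<in> S \<and> finite J \<and> (\<forall>x'\<in>S. \<forall>\<gamma>. y x' \<gamma> < 1) \<and>
      (\<forall>x'\<in>S. {\<gamma>. \<bar>\<rho> x' \<gamma>\<bar> > 1/4} \<subseteq> J)" if x: "\<And>\<gamma>. y x \<gamma> < 1" for x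
  proof -
    have "\<exists>m\<in>range (y x). \<forall>t\<in>range (y x). t \<le> m"
      using yc by (intro compact_attains_sup compact_continuous_image compact_UNIV_wellorder) auto
    then obtain c where c: "c < 1" "\<And>\<gamma>. y x \<gamma> \<le> c" using x by auto
    \<comment> \<open>A quotient above \<open>1/4\<close> near \<open>x\<close> forces a jump of at least \<open>(1 - c - d) / 4\<close>, of which two perturbations by \<open>d\<close> leave more than \<open>d\<close>.\<close>
    define d where "d = (1 - c) / 32"
    have d: "d > 0" using c by (simp add: d_def)
    define J where "J = {\<gamma>. d \<le> dist (y x \<gamma>) (y x (next_point \<gamma>))}"
    have "finite J" unfolding J_def by (rule finite_jumps[OF yc d])
    obtain S where S: "open S" "x \<in> S" "\<And>x' \<gamma>. x' \<in> S \<Longrightarrow> \<bar>y x' \<gamma> - y x \<gamma>\<bar> < d"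
      using yu[OF d, of x] unfolding eventually_nhds by blast
    have lt: "y x' \<gamma> < c + d" if "x' \<in> S" for x' \<gamma> using S(3)[OF that, of \<gamma>] c(2)[of \<gamma>] by linarith
    have d': "d < 1 - c" using d by (simp add: d_def)
    have "\<gamma> \<in> J" if x': "x' \<in> S" and "\<bar>\<rho> x' \<gamma>\<bar> > 1/4" for x' \<gamma>
    proof -
      have p: "1 - y x' (next_point \<gamma>) > 0" using lt[OF x', of "next_point \<gamma>"] d' by linarith
      have "1/4 * (1 - y x' (next_point \<gamma>)) < \<bar>\<rho> x' \<gamma>\<bar> * (1 - y x' (next_point \<gamma>))"
        by (rule mult_strict_right_mono) (use that p in auto)
      also have "\<dots> = \<bar>y x' \<gamma> - y x' (next_point \<gamma>)\<bar>" using p by (simp add: \<rho>_def abs_mult)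
      finally have "1/4 * (1 - y x' (next_point \<gamma>)) < \<bar>y x' \<gamma> - y x' (next_point \<gamma>)\<bar>" .
      then have "d \<le> \<bar>y x \<gamma> - y x (next_point \<gamma>)\<bar>"
        using S(3)[OF x', of \<gamma>] S(3)[OF x', of "next_point \<gamma>"] lt[OF x', of "next_point \<gamma>"] d
        unfolding d_def by argo
      then show ?thesis by (simp add: J_def dist_real_def)
    qed
    moreover have "y x' \<gamma> < 1" if "x' \<in> S" for x' \<gamma> using lt[OF that, of \<gamma>] d' by linarith
    ultimately show ?thesis using S(1,2) \<open>finite J\<close>
      by (intro exI[of _ S] exI[of _ J]) auto
  qed
  have "C_k_on UNIV k b"
  proof (rule C_k_on_local)
    fix x
    show "\<exists>T. x \<in> T \<and> C_k_on T k b"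
    proof (cases "\<exists>\<gamma>. 1 \<le> y x \<gamma>")
      case True
      have "closed {\<gamma>. 1 \<le> y x \<gamma>}" using yc by (intro closed_Collect_le continuous_intros) auto
      then obtain \<sigma> where \<sigma>: "1 \<le> y x \<sigma>" "\<And>\<gamma>. 1 \<le> y x \<gamma> \<Longrightarrow> \<gamma> \<le> \<sigma>"
        using closed_has_last[of "{\<gamma>. 1 \<le> y x \<gamma>}"] True by auto
      have "\<sigma> \<noteq> top" using \<sigma>(1) yt[of x] by auto
      then have "\<sigma> < next_point \<sigma>" by (intro next_point_greater) (simp add: less_top)
      then have n: "y x (next_point \<sigma>) < 1" using \<sigma>(2) by (meson not_less)
      \<comment> \<open>On \<open>T\<close> the quotient at \<open>\<sigma>\<close> exceeds \<open>1/2\<close>; the inequality is free of division and strict at \<open>x\<close>, because the quotient is at least \<open>1\<close> there.\<close>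
      define T where "T = {x'. y x' (next_point \<sigma>) < 1} \<inter>
        {x'. (1 - y x' (next_point \<sigma>)) / 2 < y x' \<sigma> - y x' (next_point \<sigma>)}"
      have "open T" unfolding T_def
        by (intro open_Int open_Collect_less continuous_intros C_k_imp_continuous[OF yC]) simp_all
      have "b x' = 0" if "x' \<in> T" for x'
      proof (cases "\<exists>\<gamma>. 1 \<le> y x' \<gamma>")
        case False
        then have "finite {\<gamma>. \<bar>\<rho> x' \<gamma>\<bar> > 1/4}"
          using below[of x'] by (meson finite_subset not_le)
        moreover have "\<rho> x' \<sigma> \<ge> 1/2"
        proof -
          have "1 - y x' (next_point \<sigma>) > 0" "(1 - y x' (next_point \<sigma>)) / 2 < y x' \<sigma> - y x' (next_point \<sigma>)"
            using that by (auto simp: T_def)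
          then show ?thesis by (simp add: \<rho>_def field_simps)
        qed
        then have "1/4 < \<bar>\<rho> x' \<sigma>\<bar>" "1/2 \<le> \<rho> x' \<sigma>" by auto
        ultimately have "(\<Prod>\<gamma> | \<bar>\<rho> x' \<gamma>\<bar> > 1/4. h (\<rho> x' \<gamma>)) = 0"
          using h0 by (intro prod_zero bexI[of _ \<sigma>]) auto
        then show ?thesis by (simp add: b_def)
      qed (simp add: b_def)
      then have "C_k_on T k b"
        by (intro C_k_on_cong[OF C_k_on_const[OF \<open>open T\<close>, of k 0] \<open>open T\<close>]) simp
      moreover have "x \<in> T" using n \<sigma>(1) by (simp add: T_def)
      ultimately show ?thesis by blast
    next
      case False
      then obtain S J where S: "open S" "x \<in> S" "finite J" "\<And>x' \<gamma>. x' \<in> S \<Longrightarrow> y x' \<gamma> < 1"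
        "\<And>x'. x' \<in> S \<Longrightarrow> {\<gamma>. \<bar>\<rho> x' \<gamma>\<bar> > 1/4} \<subseteq> J"
        using below[of x] by (meson not_le)
      have yS: "C_k_on S k (\<lambda>x. y x \<gamma>)" for \<gamma>
        by (rule C_k_on_subset[OF yC[unfolded C_k_iff_C_k_on]]) simp
      have "1 - y x' \<gamma> \<noteq> 0" if "x' \<in> S" for x' \<gamma> using S(4)[OF that, of \<gamma>] by simp
      then have "C_k_on S k (\<lambda>x. \<rho> x \<gamma>)" for \<gamma>
        unfolding \<rho>_def using S(1) yS
        by (intro C_k_on_mult C_k_on_inverse C_k_on_diff C_k_on_const) auto
      then have "C_k_on S k (\<lambda>x'. \<Prod>\<gamma>\<in>J. h (\<rho> x' \<gamma>))"
        by (intro C_k_on_prod C_k_on_compose_real[OF S(1) hC] S(1))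
      moreover have "(\<Prod>\<gamma>\<in>J. h (\<rho> x' \<gamma>)) = b x'" if "x' \<in> S" for x'
      proof -
        have "\<not> (\<exists>\<gamma>. 1 \<le> y x' \<gamma>)" using S(4)[OF that] by (simp add: not_le)
        then show ?thesis
          unfolding b_def using S(3) S(5)[OF that] h1
          by (simp add: prod.mono_neutral_right[of J "{\<gamma>. \<bar>\<rho> x' \<gamma>\<bar> > 1/4}"] not_less)
      qed
      ultimately have "C_k_on S k b" by (rule C_k_on_cong[OF _ S(1)])
      with S(2) show ?thesis by blast
    qed
  qed
  moreover have "b x \<ge> 0" for x unfolding b_def using hn by (auto intro: prod_nonneg)
  moreover have "b x = 0" if "1 \<le> y x \<gamma>" for x \<gamma> using that by (auto simp: b_def)
  moreover have "b x = 1" if "\<forall>\<gamma>. y x \<gamma> = 0" for x using that by (simp add: b_def \<rho>_def)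
  ultimately show ?thesis unfolding C_k_iff_C_k_on by blast
qed

text \<open>
  Unlike uniform continuity on \<open>C\<close>, this lets \<open>v\<close> leave \<open>C\<close>; the compact set will be the range of one
  function, to be compared with the values of nearby functions.
\<close>
lemma uniform_near_compact:
  fixes u :: "'a::metric_space \<Rightarrow> real"
  assumes u: "continuous_on UNIV u" and C: "compact C" and e: "e > 0"
  shows "\<exists>d>0. \<forall>c\<in>C. \<forall>v. dist c v < d \<longrightarrow> \<bar>u v - u c\<bar> < e"
proof -
  define G where "G c = {v. \<bar>u v - u c\<bar> < e / 2}" for c
  have "\<exists>d>0. \<forall>c\<in>C. \<exists>g\<in>range G. ball c d \<subseteq> g"
  proof (rule Heine_Borel_lemma[OF C, of "range G"])
    have "c \<in> G c" for c using e by (simp add: G_def)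
    then show "C \<subseteq> \<Union>(range G)" by blast
    have "open (G c)" for c
      unfolding G_def using u by (intro open_Collect_less continuous_intros) auto
    then show "open g" if "g \<in> range G" for g using that by auto
  qed blast
  then obtain d where d: "d > 0" "\<And>c. c \<in> C \<Longrightarrow> \<exists>g\<in>range G. ball c d \<subseteq> g"
    by meson
  have "\<bar>u v - u c\<bar> < e" if cv: "c \<in> C" "dist c v < d" for c v
  proof -
    obtain p where p: "ball c d \<subseteq> G p" using d(2)[OF cv(1)] by blast
    have "c \<in> G p" "v \<in> G p" using p cv d(1) by auto
    then have "\<bar>u c - u p\<bar> < e / 2" "\<bar>u v - u p\<bar> < e / 2" by (simp_all add: G_def)
    then show ?thesis by argo
  qed
  with d(1) show ?thesis by blast
qed

lemma bounded_linear_apply_bcontfun: "bounded_linear (\<lambda>z. apply_bcontfun z \<gamma>)"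
  for \<gamma> :: "'a::topological_space"
  by (rule bounded_linear_intro[of _ 1]) (auto intro: norm_bounded)

text \<open>
  The bump is located at the functions that are close to their own step function for \<open>F\<close>. The difference
  vanishes at the last point, as required for the family \<open>y\<close>.
\<close>
lemma bump_at_almost_step_functions:
  fixes u :: "'e::real_normed_vector \<Rightarrow> real" and a :: real
    and F :: "'o::{wellorder, order_top, linorder_topology} set"
  assumes h: "cutoff k h" and u: "C_k k u" "u 0 = 0" and F: "finite F"
  defines "y z \<gamma> \<equiv> u (a *\<^sub>R (apply_bcontfun z \<gamma> - apply_bcontfun z (next_in F \<gamma>)))"
  shows "\<exists>b :: _ \<Rightarrow> real. C_k k b \<and> (\<forall>z. 0 \<le> b z) \<and> (\<forall>z \<gamma>. 1 \<le> y z \<gamma> \<longrightarrow> b z = 0) \<and>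
    (\<forall>z. (\<forall>\<gamma>. y z \<gamma> = 0) \<longrightarrow> b z = 1)"
proof (rule ordinal_bump[OF h])
  have lin: "bounded_linear (\<lambda>z. a *\<^sub>R (apply_bcontfun z \<gamma> - apply_bcontfun z (next_in F \<gamma>)))" for \<gamma>
    by (intro bounded_linear_const_scaleR bounded_linear_sub bounded_linear_apply_bcontfun)
  show "C_k k (\<lambda>z. y z \<gamma>)" for \<gamma>
    unfolding y_def by (rule C_k_compose_linear[OF lin u(1)])
  have step: "continuous_on UNIV (\<lambda>\<gamma>. apply_bcontfun z (next_in F \<gamma>))" for z :: "'o \<Rightarrow>\<^sub>C 'e"
    unfolding continuous_on_def
  proof
    fix \<gamma>
    have "\<forall>\<^sub>F \<eta> in at \<gamma>. apply_bcontfun z (next_in F \<eta>) = apply_bcontfun z (next_in F \<gamma>)"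
      using next_in_locally_constant[OF F, of \<gamma>] unfolding eventually_at_filter
      by (rule eventually_mono) simp
    then show "((\<lambda>\<gamma>. apply_bcontfun z (next_in F \<gamma>)) \<longlongrightarrow> apply_bcontfun z (next_in F \<gamma>)) (at \<gamma>)"
      by (rule tendsto_eventually)
  qed
  have c: "continuous_on UNIV (\<lambda>\<gamma>. a *\<^sub>R (apply_bcontfun z \<gamma> - apply_bcontfun z (next_in F \<gamma>)))"
    for z :: "'o \<Rightarrow>\<^sub>C 'e"
    by (intro continuous_intros step continuous_on_apply_bcontfun)
  have uc: "continuous_on UNIV u" by (rule C_k_imp_continuous[OF u(1)])
  show "continuous_on UNIV (y z)" for z
    unfolding y_def by (rule continuous_on_compose2[OF uc c]) simp
  show "y z top = 0" for z by (simp add: y_def u(2))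
  fix z :: "'o \<Rightarrow>\<^sub>C 'e" and e :: real assume e: "e > 0"
  define w where "w z \<gamma> = a *\<^sub>R (apply_bcontfun z \<gamma> - apply_bcontfun z (next_in F \<gamma>))"
    for z :: "'o \<Rightarrow>\<^sub>C 'e" and \<gamma>
  have "compact (range (w z))"
    unfolding w_def by (rule compact_continuous_image[OF c compact_UNIV_wellorder])
  from uniform_near_compact[OF uc this e] obtain d where d: "d > 0"
      "\<forall>c\<in>range (w z). \<forall>v. dist c v < d \<longrightarrow> \<bar>u v - u c\<bar> < e" by meson
  define r where "r = d / (2 * \<bar>a\<bar> + 1)"
  have r: "r > 0" "2 * \<bar>a\<bar> * r < d" using d(1) by (auto simp: r_def field_simps)
  show "\<forall>\<^sub>F z' in nhds z. \<forall>\<gamma>. \<bar>y z' \<gamma> - y z \<gamma>\<bar> < e"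
    unfolding eventually_nhds_metric
  proof (intro exI[of _ r] conjI allI impI r(1))
    fix z' \<gamma> assume "dist z' z < r"
    then have n: "dist (apply_bcontfun z \<eta>) (apply_bcontfun z' \<eta>) \<le> r" for \<eta>
      using dist_bounded[of z \<eta> z'] by (simp add: dist_commute)
    have "dist (w z \<gamma>) (w z' \<gamma>) = \<bar>a\<bar> * dist (apply_bcontfun z \<gamma> - apply_bcontfun z (next_in F \<gamma>))
        (apply_bcontfun z' \<gamma> - apply_bcontfun z' (next_in F \<gamma>))"
      by (simp add: w_def dist_norm flip: scaleR_diff_right)
    also have "\<dots> \<le> \<bar>a\<bar> * (r + r)"
      using dist_triangle_add[of "apply_bcontfun z \<gamma>" "- apply_bcontfun z (next_in F \<gamma>)"
          "apply_bcontfun z' \<gamma>" "- apply_bcontfun z' (next_in F \<gamma>)"] n[of \<gamma>] n[of "next_in F \<gamma>"]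
      by (intro mult_left_mono) (auto simp: dist_minus)
    also have "\<dots> < d" using r(2) by (simp add: algebra_simps)
    finally have "\<bar>u (w z' \<gamma>) - u (w z \<gamma>)\<bar> < e" using d(2) by simp
    then show "\<bar>y z' \<gamma> - y z \<gamma>\<bar> < e" by (simp add: y_def w_def)
  qed
qed

lemma admits_C_k_partitions_of_unity_trivial:
  assumes "\<And>x::'x::real_normed_vector. x = 0"
  shows "admits_C_k_partitions_of_unity k TYPE('x)"
  unfolding admits_C_k_partitions_of_unity_def
proof (intro allI impI)
  fix \<V> :: "'x set set" assume "(\<forall>V\<in>\<V>. open V) \<and> \<Union>\<V> = UNIV"
  then obtain V where V: "V \<in> \<V>" "0 \<in> V" by blast
  have "V = UNIV" using V(2) assms by (metis UNIV_eq_I)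
  have C: "C_k k (\<lambda>_::'x. 1::real)"
    unfolding C_k_iff_C_k_on by (rule C_k_on_const) simp
  have "C_k_partition_of_unity k \<V> {\<lambda>_. 1}"
    unfolding C_k_partition_of_unity_def
  proof (intro conjI ballI allI)
    fix x :: 'x
    show "\<exists>U. open U \<and> x \<in> U \<and> finite {\<phi>\<in>{\<lambda>_. 1}. \<exists>y\<in>U. \<phi> y \<noteq> (0::real)}"
      by (rule exI[of _ UNIV]) simp
    show "supp_sum (\<lambda>\<phi>. \<phi> x) {\<lambda>_::'x. 1::real} = 1"
      by (subst supp_sum_eq_sum[where F = "{\<lambda>_::'x. 1::real}"]) simp_all
  next
    fix \<phi> :: "'x \<Rightarrow> real" and x assume "\<phi> \<in> {\<lambda>_. 1}"
    then have \<phi>: "\<phi> = (\<lambda>_. 1)" by simp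
    show "C_k k \<phi>" unfolding \<phi> by (rule C)
    show "0 \<le> \<phi> x" unfolding \<phi> by simp
    show "\<exists>V\<in>\<V>. closure {x. \<phi> x \<noteq> 0} \<subseteq> V" using V(1) \<open>V = UNIV\<close> by blast
  qed
  then show "\<exists>\<Phi>. C_k_partition_of_unity k \<V> \<Phi>" by blast
qed

section \<open>Partitions of unity on the function space\<close>

lemma norm_scaleR_diff: "norm (c *\<^sub>R (a - b)) = \<bar>c\<bar> * dist a b"
  for a b :: "'a::real_normed_vector"
  by (simp add: dist_norm)

text \<open>
  The products described at the beginning, with \<open>1 / Suc n\<close> for the size of the jumps and \<open>1 / Suc m\<close>
  for the radius of the balls in \<open>E\<close>. Only products supported in a member of the cover are kept; at a
  given \<open>z\<close> such a product is found by choosing first \<open>m\<close>, from the size of a ball around \<open>z\<close> within the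
  cover, and then \<open>n\<close>, from the oscillation of \<open>z\<close>.
\<close>
lemma partitions_of_unity_ordinal_interval:
  fixes u :: "'e::real_normed_vector \<Rightarrow> real"
  assumes PE: "admits_C_k_partitions_of_unity k TYPE('e)"
    and h: "cutoff k h"
    and u: "C_k k u" "\<And>x. 0 \<le> u x" "\<And>x. norm x \<le> 1/2 \<Longrightarrow> u x = 0" "\<And>x. 1 \<le> norm x \<Longrightarrow> u x = 1"
  shows "admits_C_k_partitions_of_unity k
    TYPE('o::{wellorder, order_top, linorder_topology} \<Rightarrow>\<^sub>C 'e)"
  unfolding admits_C_k_partitions_of_unity_def
proof (intro allI impI)
  fix \<V> :: "('o \<Rightarrow>\<^sub>C 'e) set set"
  assume \<V>: "(\<forall>V\<in>\<V>. open V) \<and> \<Union>\<V> = UNIV"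

  \<comment> \<open>\<open>T n \<gamma>\<close> detects jumps at \<open>\<gamma>\<close>: it is \<open>1\<close> for jumps of size at least \<open>1 / Suc n\<close> and \<open>0\<close> up to half that size.\<close>
  define T where "T n \<gamma> z = u (real (Suc n) *\<^sub>R (apply_bcontfun z \<gamma> - apply_bcontfun z (next_point \<gamma>)))"
    for n \<gamma> and z :: "'o \<Rightarrow>\<^sub>C 'e"
  define y where "y m F z \<gamma> = u (real (Suc m) *\<^sub>R
      (apply_bcontfun z \<gamma> - apply_bcontfun z (next_in F \<gamma>)))"
    for m F \<gamma> and z :: "'o \<Rightarrow>\<^sub>C 'e"
  have u0: "u 0 = 0" using u(3) by simp

  define good where "good m F b \<longleftrightarrow> C_k k b \<and> (\<forall>z. 0 \<le> b z) \<and>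
      (\<forall>z \<gamma>. 1 \<le> y m F z \<gamma> \<longrightarrow> b z = 0) \<and> (\<forall>z. (\<forall>\<gamma>. y m F z \<gamma> = 0) \<longrightarrow> b z = 1)"
    for m F and b :: "('o \<Rightarrow>\<^sub>C 'e) \<Rightarrow> real"
  define b where "b m F = (SOME b. good m F b)" for m F
  have b: "good m F (b m F)" if "finite F" for m F
    unfolding b_def
  proof (rule someI_ex[of "good m F"])
    show "\<exists>b. good m F b"
      unfolding good_def y_def by (rule bump_at_almost_step_functions[OF h u(1) u0 that])
  qed

  define \<B> where "\<B> m = range (\<lambda>c::'e. ball c (1 / real (Suc m)))" for m
  have "\<exists>\<Psi>. C_k_partition_of_unity k (\<B> m) \<Psi>" for m
  proof -
    have "(\<forall>V\<in>\<B> m. open V) \<and> \<Union>(\<B> m) = UNIV" by (force simp: \<B>_def)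
    then show ?thesis using PE unfolding admits_C_k_partitions_of_unity_def by blast
  qed
  then have "\<forall>m. \<exists>\<Psi>. C_k_partition_of_unity k (\<B> m) \<Psi>" by blast
  from choice[OF this] obtain \<Psi> where \<Psi>: "\<And>m. C_k_partition_of_unity k (\<B> m) (\<Psi> m)" by blast
  have \<Psi>C: "C_k k \<psi>" and \<Psi>n: "0 \<le> \<psi> x" and \<Psi>V: "\<exists>V\<in>\<B> m. closure {x. \<psi> x \<noteq> 0} \<subseteq> V"
    if "\<psi> \<in> \<Psi> m" for m \<psi> x
    using \<Psi>[of m] that unfolding C_k_partition_of_unity_def by blast+
  have \<Psi>lf: "\<exists>U. open U \<and> x \<in> U \<and> finite {\<psi>\<in>\<Psi> m. \<exists>y\<in>U. \<psi> y \<noteq> 0}" for m x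
    using \<Psi>[of m] unfolding C_k_partition_of_unity_def by blast
  have \<Psi>pos: "\<exists>\<psi>\<in>\<Psi> m. \<psi> x \<noteq> 0" for m x
  proof (rule ccontr)
    assume "\<not> ?thesis"
    then have "supp_sum (\<lambda>\<psi>. \<psi> x) (\<Psi> m) = 0"
      by (auto simp: supp_sum_def support_on_def intro!: sum.neutral)
    then show False using \<Psi>[of m] unfolding C_k_partition_of_unity_def by simp
  qed

  define \<theta> where "\<theta> n m F \<sigma> z = (\<Prod>\<gamma>\<in>F. T n \<gamma> z) *
      (\<Prod>\<gamma>\<in>insert top F. (\<sigma> \<gamma>) (apply_bcontfun z \<gamma>)) * b m F z"
    for n m F and \<sigma> :: "'o \<Rightarrow> 'e \<Rightarrow> real" and z
  have TC: "C_k k (T n \<gamma>)" for n \<gamma>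
  proof -
    have "bounded_linear (\<lambda>z. real (Suc n) *\<^sub>R (apply_bcontfun z \<gamma> - apply_bcontfun z (next_point \<gamma>)))"
      by (intro bounded_linear_const_scaleR bounded_linear_sub bounded_linear_apply_bcontfun)
    then show ?thesis unfolding T_def[abs_def] using u(1) by (rule C_k_compose_linear)
  qed
  have \<theta>C: "C_k k (\<theta> n m F \<sigma>)" if "finite F" "\<sigma> \<in> Pi\<^sub>E (insert top F) (\<lambda>_. \<Psi> m)" for n m F \<sigma>
  proof -
    have "C_k k (\<lambda>z. (\<sigma> \<gamma>) (apply_bcontfun z \<gamma>))" if "\<gamma> \<in> insert top F" for \<gamma>
      using that \<open>\<sigma> \<in> _\<close>
      by (intro C_k_compose_linear[OF bounded_linear_apply_bcontfun] \<Psi>C[of "\<sigma> \<gamma>" m]) auto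
    moreover have "C_k k (b m F)" using b[OF that(1)] by (simp add: good_def)
    ultimately show ?thesis
      unfolding \<theta>_def[abs_def] using TC
      unfolding C_k_iff_C_k_on by (intro C_k_on_mult C_k_on_prod open_UNIV)
  qed
  have \<theta>n: "0 \<le> \<theta> n m F \<sigma> z" if "finite F" "\<sigma> \<in> Pi\<^sub>E (insert top F) (\<lambda>_. \<Psi> m)" for n m F \<sigma> z
  proof -
    have "0 \<le> (\<sigma> \<gamma>) (apply_bcontfun z \<gamma>)" if "\<gamma> \<in> insert top F" for \<gamma>
      using that \<open>\<sigma> \<in> _\<close> by (intro \<Psi>n[of "\<sigma> \<gamma>" m]) auto
    moreover have "0 \<le> b m F z" using b[OF that(1)] by (simp add: good_def)
    ultimately show ?thesis
      unfolding \<theta>_def T_def by (intro mult_nonneg_nonneg prod_nonneg ballI u(2))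
  qed
  have \<theta>0: "(\<forall>\<gamma>\<in>F. T n \<gamma> z \<noteq> 0) \<and> (\<forall>\<gamma>\<in>insert top F. (\<sigma> \<gamma>) (apply_bcontfun z \<gamma>) \<noteq> 0) \<and> b m F z \<noteq> 0"
    if "finite F" "\<theta> n m F \<sigma> z \<noteq> 0" for n m F \<sigma> z
    using that by (simp add: \<theta>_def)

  \<comment> \<open>From \<open>z \<gamma>\<close> pass to \<open>z \<alpha>\<close>, the center of the ball for \<open>\<sigma> \<alpha>\<close>, \<open>w \<alpha>\<close> and \<open>w \<gamma>\<close>, with \<open>\<alpha>\<close> the next point of \<open>F\<close>.\<close>
  have close: "dist z w \<le> 4 / real (Suc m)"
    if F: "finite F" and \<sigma>: "\<sigma> \<in> Pi\<^sub>E (insert top F) (\<lambda>_. \<Psi> m)"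
      and z: "\<theta> n m F \<sigma> z \<noteq> 0" and w: "\<theta> n m F \<sigma> w \<noteq> 0" for n m F \<sigma> z w
  proof (rule dist_bound)
    fix \<gamma>
    define \<alpha> where "\<alpha> = next_in F \<gamma>"
    have \<alpha>: "\<alpha> \<in> insert top F" unfolding \<alpha>_def by (rule next_in(2))
    have step: "dist (apply_bcontfun x \<gamma>) (apply_bcontfun x \<alpha>) < 1 / real (Suc m)"
      if "\<theta> n m F \<sigma> x \<noteq> 0" for x
    proof -
      have "\<not> 1 \<le> y m F x \<gamma>" using b[OF F] \<theta>0[OF F that] unfolding good_def by blast
      then have "\<not> 1 \<le> norm (real (Suc m) *\<^sub>R (apply_bcontfun x \<gamma> - apply_bcontfun x \<alpha>))"
        using u(4) unfolding y_def \<alpha>_def by force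
      then show ?thesis by (simp only: norm_scaleR_diff abs_of_nat) (simp add: field_simps del: of_nat_Suc)
    qed
    have "\<sigma> \<alpha> \<in> \<Psi> m" using \<sigma> \<alpha> by auto
    from \<Psi>V[OF this] obtain c where c: "closure {x. \<sigma> \<alpha> x \<noteq> 0} \<subseteq> ball c (1 / real (Suc m))"
      by (auto simp: \<B>_def)
    have inball: "dist c (apply_bcontfun x \<alpha>) < 1 / real (Suc m)" if "\<theta> n m F \<sigma> x \<noteq> 0" for x
    proof -
      have "\<sigma> \<alpha> (apply_bcontfun x \<alpha>) \<noteq> 0" using \<theta>0[OF F that] \<alpha> by blast
      then have "apply_bcontfun x \<alpha> \<in> closure {x. \<sigma> \<alpha> x \<noteq> 0}"
        using closure_subset[of "{x. \<sigma> \<alpha> x \<noteq> 0}"] by blast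
      with c show ?thesis by auto
    qed
    have "dist (apply_bcontfun z \<gamma>) (apply_bcontfun w \<gamma>) \<le>
        dist (apply_bcontfun z \<gamma>) (apply_bcontfun z \<alpha>) + dist c (apply_bcontfun z \<alpha>) +
        dist c (apply_bcontfun w \<alpha>) + dist (apply_bcontfun w \<gamma>) (apply_bcontfun w \<alpha>)"
      by metric
    also have "\<dots> \<le> 1 / real (Suc m) + 1 / real (Suc m) + 1 / real (Suc m) + 1 / real (Suc m)"
      using step[OF z] step[OF w] inball[OF z] inball[OF w] by linarith
    finally show "dist (apply_bcontfun z \<gamma>) (apply_bcontfun w \<gamma>) \<le> 4 / real (Suc m)" by simp
  qed

  define \<Phi> where "\<Phi> i = (case prod_decode i of (n, m) \<Rightarrow>
      {\<phi>. (\<exists>F \<sigma>. finite F \<and> \<sigma> \<in> Pi\<^sub>E (insert top F) (\<lambda>_. \<Psi> m) \<and> \<phi> = \<theta> n m F \<sigma>) \<and>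
        (\<exists>V\<in>\<V>. closure {z. \<phi> z \<noteq> 0} \<subseteq> V)})" for i
  show "\<exists>\<Phi>. C_k_partition_of_unity k \<V> \<Phi>"
  proof (rule partition_of_unity_from_sigma_locally_finite[OF h, of \<Phi>])
    fix i
    obtain n m where i: "prod_decode i = (n, m)" by force
    show "C_k k \<phi>" "0 \<le> \<phi> z" "\<exists>V\<in>\<V>. closure {x. \<phi> x \<noteq> 0} \<subseteq> V" if "\<phi> \<in> \<Phi> i" for \<phi> z
      using that \<theta>C \<theta>n by (auto simp: \<Phi>_def i)
    show "locally_finite_supports (\<Phi> i)"
      unfolding locally_finite_supports_def
    proof
      fix z :: "'o \<Rightarrow>\<^sub>C 'e"
      define N where "N = real (Suc n)"
      have N: "N > 0" by (simp add: N_def)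
      \<comment> \<open>Detected jumps are larger than \<open>4 * d\<close>; a function within \<open>d\<close> still has there a jump of size at least \<open>2 * d\<close>.\<close>
      define d where "d = 1 / (8 * N)"
      have d: "d > 0" using N by (simp add: d_def)
      define J where "J = {\<gamma>. 2 * d \<le> dist (apply_bcontfun z \<gamma>) (apply_bcontfun z (next_point \<gamma>))}"
      have J: "finite J" unfolding J_def using d by (intro finite_jumps[of "apply_bcontfun z"]) auto
      have "\<forall>\<gamma>. \<exists>U. open U \<and> apply_bcontfun z \<gamma> \<in> U \<and> finite {\<psi>\<in>\<Psi> m. \<exists>y\<in>U. \<psi> y \<noteq> 0}"
        using \<Psi>lf by blast
      from choice[OF this] obtain W where W: "\<And>\<gamma>. open (W \<gamma>)" "\<And>\<gamma>. apply_bcontfun z \<gamma> \<in> W \<gamma>"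
        "\<And>\<gamma>. finite {\<psi>\<in>\<Psi> m. \<exists>y\<in>W \<gamma>. \<psi> y \<noteq> 0}" by blast
      define P where "P \<gamma> = {\<psi>\<in>\<Psi> m. \<exists>y\<in>W \<gamma>. \<psi> y \<noteq> 0}" for \<gamma>
      define U where "U = ball z d \<inter> (\<Inter>\<gamma>\<in>insert top J. (\<lambda>x. apply_bcontfun x \<gamma>) -` W \<gamma>)"
      have "open ((\<lambda>x. apply_bcontfun x \<gamma>) -` W \<gamma>)" for \<gamma>
        by (intro open_vimage W linear_continuous_on bounded_linear_apply_bcontfun)
      then have "open U" unfolding U_def using J by (intro open_Int open_INT) auto
      moreover have "z \<in> U" using W(2) d by (simp add: U_def)
      moreover have "{\<phi>\<in>\<Phi> i. \<exists>x\<in>U. \<phi> x \<noteq> 0} \<subseteq>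
          (\<Union>F\<in>Pow J. \<theta> n m F ` Pi\<^sub>E (insert top F) P)"
      proof
        fix \<phi> assume "\<phi> \<in> {\<phi>\<in>\<Phi> i. \<exists>x\<in>U. \<phi> x \<noteq> 0}"
        then obtain F \<sigma> x where F: "finite F" and \<sigma>: "\<sigma> \<in> Pi\<^sub>E (insert top F) (\<lambda>_. \<Psi> m)"
          and \<phi>: "\<phi> = \<theta> n m F \<sigma>" and x: "x \<in> U" "\<theta> n m F \<sigma> x \<noteq> 0"
          by (auto simp: \<Phi>_def i)
        have "F \<subseteq> J"
        proof
          fix \<gamma> assume "\<gamma> \<in> F"
          then have "T n \<gamma> x \<noteq> 0" using \<theta>0[OF F x(2)] by blast
          then have "\<not> norm (N *\<^sub>R (apply_bcontfun x \<gamma> - apply_bcontfun x (next_point \<gamma>))) \<le> 1/2"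
            using u(3) unfolding T_def N_def by blast
          then have "4 * d < dist (apply_bcontfun x \<gamma>) (apply_bcontfun x (next_point \<gamma>))"
            using N by (simp only: norm_scaleR_diff d_def) (simp add: field_simps)
          moreover have "dist (apply_bcontfun z \<eta>) (apply_bcontfun x \<eta>) < d" for \<eta>
            using x(1) dist_fun_lt_imp_dist_val_lt[of z x d] by (simp add: U_def)
          from this[of \<gamma>] this[of "next_point \<gamma>"]
          have "dist (apply_bcontfun x \<gamma>) (apply_bcontfun x (next_point \<gamma>)) <
              dist (apply_bcontfun z \<gamma>) (apply_bcontfun z (next_point \<gamma>)) + 2 * d" by metric
          ultimately show "\<gamma> \<in> J" by (simp add: J_def)
        qed
        moreover have "\<sigma> \<in> Pi\<^sub>E (insert top F) P"
        proof (rule PiE_I)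
          fix \<gamma> assume \<gamma>: "\<gamma> \<in> insert top F"
          then have "apply_bcontfun x \<gamma> \<in> W \<gamma>" using x(1) \<open>F \<subseteq> J\<close> by (auto simp: U_def)
          moreover have "\<sigma> \<gamma> (apply_bcontfun x \<gamma>) \<noteq> 0" using \<theta>0[OF F x(2)] \<gamma> by blast
          ultimately show "\<sigma> \<gamma> \<in> P \<gamma>" using \<sigma> \<gamma> unfolding P_def by blast
        qed (use \<sigma> in auto)
        ultimately show "\<phi> \<in> (\<Union>F\<in>Pow J. \<theta> n m F ` Pi\<^sub>E (insert top F) P)" using \<phi> by blast
      qed
      moreover have "finite (\<Union>F\<in>Pow J. \<theta> n m F ` Pi\<^sub>E (insert top F) P)"
        using J W(3) by (intro finite_UN_I finite_imageI finite_PiE)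
          (auto simp: P_def intro: finite_subset)
      ultimately show "\<exists>U. open U \<and> z \<in> U \<and> finite {\<phi>\<in>\<Phi> i. \<exists>x\<in>U. \<phi> x \<noteq> 0}"
        by (meson finite_subset)
    qed
  next
    fix z :: "'o \<Rightarrow>\<^sub>C 'e"
    obtain V where V: "V \<in> \<V>" "open V" "z \<in> V" using \<V> by blast
    then obtain e where e: "e > 0" "ball z e \<subseteq> V" using open_contains_ball by blast
    obtain m where m: "inverse (real (Suc m)) < e / 4" using reals_Archimedean[of "e / 4"] e by auto
    define M where "M = real (Suc m)"
    have M: "M > 0" "4 / M < e" using m by (simp_all add: M_def field_simps)
    obtain \<delta> where \<delta>: "\<delta> > 0" and osc: "\<And>\<gamma> \<alpha>. \<gamma> \<le> \<alpha> \<Longrightarrow>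
        (\<And>\<eta>. \<gamma> \<le> \<eta> \<and> \<eta> < \<alpha> \<Longrightarrow> dist (apply_bcontfun z \<eta>) (apply_bcontfun z (next_point \<eta>)) < \<delta>) \<Longrightarrow>
        dist (apply_bcontfun z \<gamma>) (apply_bcontfun z \<alpha>) < 1 / (2 * M)"
      using oscillation_between_jumps[of "apply_bcontfun z" "1 / (2 * M)" top] M(1)
      by (auto simp: continuous_on_apply_bcontfun)
    obtain n where n: "inverse (real (Suc n)) < \<delta>" using reals_Archimedean[OF \<delta>] by auto
    \<comment> \<open>Between points of \<open>F\<close> all jumps are less than \<open>1 / Suc n\<close>, hence less than \<open>\<delta>\<close>.\<close>
    define F where "F = {\<gamma>. T n \<gamma> z \<noteq> 0}"
    have "F \<subseteq> {\<gamma>. 1 / (2 * real (Suc n)) \<le> dist (apply_bcontfun z \<gamma>) (apply_bcontfun z (next_point \<gamma>))}"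
    proof
      fix \<gamma> assume "\<gamma> \<in> F"
      then have "\<not> norm (real (Suc n) *\<^sub>R (apply_bcontfun z \<gamma> - apply_bcontfun z (next_point \<gamma>))) \<le> 1/2"
        using u(3) unfolding T_def F_def by blast
      then show "\<gamma> \<in> {\<gamma>. 1 / (2 * real (Suc n)) \<le> dist (apply_bcontfun z \<gamma>) (apply_bcontfun z (next_point \<gamma>))}"
        by (simp only: norm_scaleR_diff abs_of_nat) (simp add: field_simps del: of_nat_Suc)
    qed
    then have F: "finite F"
      by (rule finite_subset) (intro finite_jumps[of "apply_bcontfun z"] continuous_on_apply_bcontfun, simp)
    have "y m F z \<gamma> = 0" for \<gamma>
    proof -
      have "dist (apply_bcontfun z \<gamma>) (apply_bcontfun z (next_in F \<gamma>)) < 1 / (2 * M)"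
      proof (rule osc[OF next_in(1)])
        fix \<eta> assume \<eta>: "\<gamma> \<le> \<eta> \<and> \<eta> < next_in F \<gamma>"
        then have "\<eta> \<notin> F" using next_in_le[of \<gamma> \<eta> F] by auto
        then have "\<not> 1 \<le> norm (real (Suc n) *\<^sub>R (apply_bcontfun z \<eta> - apply_bcontfun z (next_point \<eta>)))"
          using u(4) unfolding F_def T_def by force
        then have "dist (apply_bcontfun z \<eta>) (apply_bcontfun z (next_point \<eta>)) < inverse (real (Suc n))"
          by (simp only: norm_scaleR_diff abs_of_nat) (simp add: field_simps del: of_nat_Suc)
        with n show "dist (apply_bcontfun z \<eta>) (apply_bcontfun z (next_point \<eta>)) < \<delta>" by linarith
      qed
      then have "norm (M *\<^sub>R (apply_bcontfun z \<gamma> - apply_bcontfun z (next_in F \<gamma>))) \<le> 1/2"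
        using M(1) by (simp only: norm_scaleR_diff) (simp add: field_simps)
      then show ?thesis unfolding y_def M_def by (rule u(3))
    qed
    then have "b m F z = 1" using b[OF F, of m] unfolding good_def by blast
    moreover
    have "\<forall>\<gamma>. \<exists>\<psi>. \<psi> \<in> \<Psi> m \<and> \<psi> (apply_bcontfun z \<gamma>) \<noteq> 0" using \<Psi>pos by blast
    from choice[OF this] obtain \<tau> where \<tau>: "\<And>\<gamma>. \<tau> \<gamma> \<in> \<Psi> m" "\<And>\<gamma>. \<tau> \<gamma> (apply_bcontfun z \<gamma>) \<noteq> 0"
      by blast
    define \<sigma> where "\<sigma> = restrict \<tau> (insert top F)"
    have \<sigma>: "\<sigma> \<in> Pi\<^sub>E (insert top F) (\<lambda>_. \<Psi> m)" unfolding \<sigma>_def using \<tau>(1) by auto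
    have "\<sigma> \<gamma> (apply_bcontfun z \<gamma>) \<noteq> 0" if "\<gamma> \<in> insert top F" for \<gamma>
      using that \<tau>(2) by (simp add: \<sigma>_def)
    then have "(\<Prod>\<gamma>\<in>insert top F. \<sigma> \<gamma> (apply_bcontfun z \<gamma>)) \<noteq> 0"
      using F by (subst prod_zero_iff) auto
    moreover have "(\<Prod>\<gamma>\<in>F. T n \<gamma> z) \<noteq> 0" using F by (subst prod_zero_iff) (auto simp: F_def)
    ultimately have z: "\<theta> n m F \<sigma> z \<noteq> 0" by (simp add: \<theta>_def)
    have "closure {x. \<theta> n m F \<sigma> x \<noteq> 0} \<subseteq> cball z (4 / M)"
      using close[OF F \<sigma> z] by (intro closure_minimal) (auto simp: M_def)
    also have "\<dots> \<subseteq> ball z e" using M(2) by auto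
    finally have "closure {x. \<theta> n m F \<sigma> x \<noteq> 0} \<subseteq> V" using e(2) by blast
    then have "\<theta> n m F \<sigma> \<in> \<Phi> (prod_encode (n, m))"
      using F \<sigma> V(1) by (auto simp: \<Phi>_def)
    with z show "\<exists>i. \<exists>\<phi>\<in>\<Phi> i. \<phi> z \<noteq> 0" by blast
  qed
qed

theorem corollary5:
  fixes k :: enat
  assumes "k \<ge> 1"
    and "admits_C_k_partitions_of_unity k TYPE('e::banach)"
  shows "admits_C_k_partitions_of_unity k
    TYPE('\<Omega>::{wellorder, order_top, linorder_topology} \<Rightarrow>\<^sub>C 'e)"
proof (cases "\<exists>a::'e. a \<noteq> 0")
  case True
  then obtain a :: 'e where a: "a \<noteq> 0" by blast
  obtain u :: "'e \<Rightarrow> real" where u: "C_k k u" "\<And>x. 0 \<le> u x"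
      "\<And>x. norm x \<le> 1/2 \<Longrightarrow> u x = 0" "\<And>x. 1 \<le> norm x \<Longrightarrow> u x = 1"
    using C_k_separating_zero[OF assms(2)] by blast
  obtain h where "cutoff k h" using cutoff_exists[OF u(1,3,4) a] by blast
  then show ?thesis by (rule partitions_of_unity_ordinal_interval[OF assms(2) _ u])
next
  case False
  \<comment> \<open>If \<open>E\<close> is the zero space, there is no line in it to carry a cutoff, but the function space is zero, too.\<close>
  then have "x = 0" for x :: "'\<Omega> \<Rightarrow>\<^sub>C 'e" by (intro bcontfun_eqI) auto
  then show ?thesis by (rule admits_C_k_partitions_of_unity_trivial)
qed

end
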